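(* Let $n,d\ge1$, let $H$ be a nonzero $2^n\times2^n$ complex matrix, and let $p_d(H)=a_0I+a_1H+\cdots+a_dH^d$ be a degree-$d$ matrix polynomial with $a_k\in\mathbb C$, $a_d\neq0$. Then the $(d+(2d+1)n)$-qubit circuit $$W=\mathrm{POLY}_L^\dagger\cdot\big[C_1(P_L^\dagger)\,C_2(P_L^\dagger)\cdots C_d(P_L^\dagger)\big]\cdot\big[\mathrm{SELECT}_d\cdots\mathrm{SELECT}_2\,\mathrm{SELECT}_1\big]\cdot\big[C_d(P_R)\cdots C_2(P_R)\,C_1(P_R)\big]\cdot\mathrm{POLY}_R$$ (notation in the context) implements a block encoding of $p_d(H)$: there is a nonzero scalar $c\in\mathbb C$ such that for every $n$-qubit state $|\varphi\rangle$ $$\big(\langle 0|_{d}\otimes\langle0|_{2dn}\otimes I_n\big)\,W\,\big(|0\rangle_d\otimes|0\rangle_{2dn}\otimes|\varphi\rangle\big)=c\;p_d(H)|\varphi\rangle .$$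
   Context: $I_m$ is the identity on $m$ qubits, $|0\rangle_m$ the all-zero state of $m$ qubits. For $i\in\{0,\dots,2^n-1\}$ with bits $\mathtt i_0,\dots,\mathtt i_{n-1}$, $|i\rangle=|\mathtt i_0\rangle\otimes\cdots\otimes|\mathtt i_{n-1}\rangle$. $X,Z$ are the Pauli matrices. $\arg 0$ is given any fixed value. Write $H=\sum_{i,j=0}^{2^n-1}\alpha_{ij}\bigotimes_{\ell=0}^{n-1}Z^{\mathtt j_\ell}X^{\mathtt i_\ell}$ with $\alpha_{ij}\in\mathbb C$ and $\mathcal N=\sum_{i,j}|\alpha_{ij}|$. $P_R,P_L$ are unitaries on $2n$ qubits with $$P_R|0\rangle_{2n}=\tfrac1{\sqrt{\mathcal N}}\sum_{i,j}e^{\mathrm i\arg\alpha_{ij}}\sqrt{|\alpha_{ij}|}\,|i\rangle|j\rangle,\qquad P_L|0\rangle_{2n}=\tfrac1{\sqrt{\mathcal N}}\sum_{i,j}\sqrt{|\alpha_{ij}|}\,|i\rangle|j\rangle .$$ $\mathrm{SELECT}$ acts on three $n$-qubit registers by $\mathrm{SELECT}\,|i\rangle|j\rangle|\varphi\rangle=|i\rangle|j\rangle\otimes\big(\bigotimes_{\ell}Z^{\mathtt j_\ell}X^{\mathtt i_\ell}\big)|\varphi\rangle$ (a layer of $n$ CNOTs followed by a layer of $n$ CZs). Let $w_k=\sqrt{|a_k|\mathcal N^k}$ for $0\le k\le d$, $\phi_k=\arg(a_{k+1})-\arg(a_k)$ for $0\le k\le d-1$, and $\mathcal W=\sum_{k=0}^d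 w_k^2$. Let $|k_u\rangle$ be the unary $d$-qubit state $|1\cdots10\cdots0\rangle$ with $k$ leading ones. $\mathrm{POLY}_R,\mathrm{POLY}_L$ are unitaries on $d$ qubits with $$\mathrm{POLY}_R|0\rangle_d=\tfrac1{\sqrt{\mathcal W}}\sum_{k=0}^d e^{\mathrm i\sum_{j=0}^{k-1}\phi_j}w_k|k_u\rangle,\qquad \mathrm{POLY}_L|0\rangle_d=\tfrac1{\sqrt{\mathcal W}}\sum_{k=0}^d w_k|k_u\rangle .$$ The qubits of the circuit are: $d$ outer ancillas; $d$ inner ancilla registers of $2n$ qubits each, labelled $s=1,\dots,d$; and an $n$-qubit system register. $\mathrm{POLY}_R$ and $\mathrm{POLY}_L^\dagger$ act on the outer ancillas. $C_s(V)$ is the gate $V$ on the $s$-th inner register controlled (on value $1$) by the $s$-th outer ancilla. $\mathrm{SELECT}_s$ is $\mathrm{SELECT}$ acting on the $s$-th inner register and the system register. Operators act from right to left and trivially on unmentioned qubits. A block encoding is understood up to normalization and an irrelevant global phase, i.e. up to a nonzero complex scalar factor. *)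

theory Defs
  imports Complex_Main "Jordan_Normal_Form.Schur_Decomposition"
begin

section \<open>Tensor products\<close>

definition tensor_vec :: "complex vec \<Rightarrow> complex vec \<Rightarrow> complex vec" (infixr \<open>\<otimes>\<^sub>v\<close> 75) where
  "v \<otimes>\<^sub>v w = vec (dim_vec v * dim_vec w) (\<lambda>k. v $ (k div dim_vec w) * w $ (k mod dim_vec w))"

definition tensor_mat :: "complex mat \<Rightarrow> complex mat \<Rightarrow> complex mat" (infixr \<open>\<otimes>\<^sub>m\<close> 75) where
  "A \<otimes>\<^sub>m B = mat (dim_row A * dim_row B) (dim_col A * dim_col B)
     (\<lambda>(r, c). A $$ (r div dim_row B, c div dim_col B) * B $$ (r mod dim_row B, c mod dim_col B))"

definition tensor_vecs :: "complex vec list \<Rightarrow> complex vec" where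
  "tensor_vecs vs = foldr (\<otimes>\<^sub>v) vs (vec 1 (\<lambda>_. 1))"

definition tensor_mats :: "complex mat list \<Rightarrow> complex mat" where
  "tensor_mats As = foldr (\<otimes>\<^sub>m) As (1\<^sub>m 1)"

definition mat_sum :: "nat \<Rightarrow> ('i \<Rightarrow> complex mat) \<Rightarrow> 'i set \<Rightarrow> complex mat" where
  "mat_sum N A I = mat N N (\<lambda>rc. \<Sum>i\<in>I. A i $$ rc)"

text \<open>Composition of a list of operators, written in the order of a product: the last one acts first.\<close>

definition mat_prod :: "nat \<Rightarrow> complex mat list \<Rightarrow> complex mat" where
  "mat_prod N As = foldr (*) As (1\<^sub>m N)"

definition unitary_mat :: "nat \<Rightarrow> complex mat \<Rightarrow> bool" where
  "unitary_mat N U \<longleftrightarrow>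
     U \<in> carrier_mat N N \<and> mat_adjoint U * U = 1\<^sub>m N \<and> U * mat_adjoint U = 1\<^sub>m N"


section \<open>Qubits and gates\<close>

text \<open>
  The state space of \<open>m\<close> qubits is \<open>carrier_vec (2 ^ m)\<close>. Qubit \<open>0\<close> is the leftmost tensor factor,
  so it carries the most significant bit of the index of a basis vector.
\<close>

definition qbit :: "nat \<Rightarrow> nat \<Rightarrow> nat \<Rightarrow> nat" where
  "qbit m x q = x div 2 ^ (m - 1 - q) mod 2"

definition ket :: "nat \<Rightarrow> nat \<Rightarrow> complex vec" where
  "ket m x = unit_vec (2 ^ m) x"

definition bra0 :: "nat \<Rightarrow> complex mat" where
  "bra0 m = mat_adjoint (mat_of_cols (2 ^ m) [ket m 0])"

text \<open>The number whose bits, most significant first, are the bits of \<open>x\<close> at the qubits \<open>qs\<close>.\<close>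

definition sub_index :: "nat \<Rightarrow> nat list \<Rightarrow> nat \<Rightarrow> nat" where
  "sub_index m qs x = foldl (\<lambda>acc q. 2 * acc + qbit m x q) 0 qs"

text \<open>
  \<open>gate_on m qs V\<close> is the operator on \<open>m\<close> qubits that applies the gate \<open>V\<close> to the distinct qubits
  \<open>qs\<close>, the \<open>r\<close>-th tensor factor of \<open>V\<close> being qubit \<open>qs ! r\<close>, and acts trivially on all other qubits.
\<close>

definition gate_on :: "nat \<Rightarrow> nat list \<Rightarrow> complex mat \<Rightarrow> complex mat" where
  "gate_on m qs V = mat (2 ^ m) (2 ^ m) (\<lambda>(x, y).
     if \<forall>q<m. q \<notin> set qs \<longrightarrow> qbit m x q = qbit m y q
     then V $$ (sub_index m qs x, sub_index m qs y) else 0)"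

text \<open>The control is the first qubit.\<close>

definition controlled :: "complex mat \<Rightarrow> complex mat" where
  "controlled V = (let M = dim_row V in four_block_mat (1\<^sub>m M) (0\<^sub>m M M) (0\<^sub>m M M) V)"

definition pauli_X :: "complex mat" where
  "pauli_X = mat_of_rows_list 2 [[0, 1], [1, 0]]"

definition pauli_Z :: "complex mat" where
  "pauli_Z = mat_of_rows_list 2 [[1, 0], [0, -1]]"

definition pauli_string :: "nat \<Rightarrow> nat \<Rightarrow> nat \<Rightarrow> complex mat" where
  "pauli_string n i j =
     tensor_mats (map (\<lambda>l. (pauli_Z ^\<^sub>m qbit n j l) * (pauli_X ^\<^sub>m qbit n i l)) [0..<n])"

text \<open>
  The block diagonal matrix whose block at \<open>|i\<rangle>|j\<rangle>\<close>, the block number \<open>i * 2 ^ n + j\<close>, is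
  \<open>pauli_string n i j\<close>; see \<open>select_ket\<close> below.
\<close>

definition select :: "nat \<Rightarrow> complex mat" where
  "select n = mat (2 ^ (3 * n)) (2 ^ (3 * n)) (\<lambda>(x, y).
     let b = x div 2 ^ n in
     if b = y div 2 ^ n
     then pauli_string n (b div 2 ^ n) (b mod 2 ^ n) $$ (x mod 2 ^ n, y mod 2 ^ n) else 0)"


section \<open>Input data of the circuit\<close>

text \<open>The principal argument, except that the argument of \<open>0\<close> is \<open>\<theta>\<close>.\<close>

definition arg_at0 :: "real \<Rightarrow> complex \<Rightarrow> real" where
  "arg_at0 \<theta> = Arg(0 := \<theta>)"

definition pauli_sum :: "nat \<Rightarrow> (nat \<Rightarrow> nat \<Rightarrow> complex) \<Rightarrow> complex mat" where
  "pauli_sum n \<alpha> = mat_sum (2 ^ n) (\<lambda>(i, j). \<alpha> i j \<cdot>\<^sub>m pauli_string n i j) ({..<2 ^ n} \<times> {..<2 ^ n})"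

definition coeff_norm :: "nat \<Rightarrow> (nat \<Rightarrow> nat \<Rightarrow> complex) \<Rightarrow> real" where
  "coeff_norm n \<alpha> = (\<Sum>i<2 ^ n. \<Sum>j<2 ^ n. cmod (\<alpha> i j))"

definition PR_state :: "real \<Rightarrow> nat \<Rightarrow> (nat \<Rightarrow> nat \<Rightarrow> complex) \<Rightarrow> complex vec" where
  "PR_state \<theta> n \<alpha> = complex_of_real (1 / sqrt (coeff_norm n \<alpha>)) \<cdot>\<^sub>v
     finsum_vec TYPE(complex) (2 ^ (2 * n))
       (\<lambda>(i, j). (cis (arg_at0 \<theta> (\<alpha> i j)) * complex_of_real (sqrt (cmod (\<alpha> i j)))) \<cdot>\<^sub>v
                 (ket n i \<otimes>\<^sub>v ket n j))
       ({..<2 ^ n} \<times> {..<2 ^ n})"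

definition PL_state :: "nat \<Rightarrow> (nat \<Rightarrow> nat \<Rightarrow> complex) \<Rightarrow> complex vec" where
  "PL_state n \<alpha> = complex_of_real (1 / sqrt (coeff_norm n \<alpha>)) \<cdot>\<^sub>v
     finsum_vec TYPE(complex) (2 ^ (2 * n))
       (\<lambda>(i, j). complex_of_real (sqrt (cmod (\<alpha> i j))) \<cdot>\<^sub>v (ket n i \<otimes>\<^sub>v ket n j))
       ({..<2 ^ n} \<times> {..<2 ^ n})"

definition unary_ket :: "nat \<Rightarrow> nat \<Rightarrow> complex vec" where
  "unary_ket d k = tensor_vecs (map (\<lambda>l. if l < k then ket 1 1 else ket 1 0) [0..<d])"

definition poly_weight :: "(nat \<Rightarrow> complex) \<Rightarrow> real \<Rightarrow> nat \<Rightarrow> real" where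
  "poly_weight a N k = sqrt (cmod (a k) * N ^ k)"

definition poly_phase :: "real \<Rightarrow> (nat \<Rightarrow> complex) \<Rightarrow> nat \<Rightarrow> real" where
  "poly_phase \<theta> a k = arg_at0 \<theta> (a (Suc k)) - arg_at0 \<theta> (a k)"

definition poly_norm :: "nat \<Rightarrow> (nat \<Rightarrow> complex) \<Rightarrow> real \<Rightarrow> real" where
  "poly_norm d a N = (\<Sum>k\<le>d. (poly_weight a N k)\<^sup>2)"

definition POLYR_state :: "real \<Rightarrow> nat \<Rightarrow> (nat \<Rightarrow> complex) \<Rightarrow> real \<Rightarrow> complex vec" where
  "POLYR_state \<theta> d a N = complex_of_real (1 / sqrt (poly_norm d a N)) \<cdot>\<^sub>v
     finsum_vec TYPE(complex) (2 ^ d)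
       (\<lambda>k. (cis (\<Sum>j<k. poly_phase \<theta> a j) * complex_of_real (poly_weight a N k)) \<cdot>\<^sub>v unary_ket d k)
       {..d}"

definition POLYL_state :: "nat \<Rightarrow> (nat \<Rightarrow> complex) \<Rightarrow> real \<Rightarrow> complex vec" where
  "POLYL_state d a N = complex_of_real (1 / sqrt (poly_norm d a N)) \<cdot>\<^sub>v
     finsum_vec TYPE(complex) (2 ^ d)
       (\<lambda>k. complex_of_real (poly_weight a N k) \<cdot>\<^sub>v unary_ket d k) {..d}"

definition matrix_poly :: "nat \<Rightarrow> nat \<Rightarrow> (nat \<Rightarrow> complex) \<Rightarrow> complex mat \<Rightarrow> complex mat" where
  "matrix_poly N d a H = mat_sum N (\<lambda>k. a k \<cdot>\<^sub>m (H ^\<^sub>m k)) {..d}"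


section \<open>The circuit\<close>

text \<open>
  Qubits \<open>0, \<dots>, d - 1\<close> are the outer ancillas, followed by the inner registers \<open>s = 1, \<dots>, d\<close> of
  \<open>2 * n\<close> qubits each and by the system register. The \<open>s\<close>-th outer ancilla is qubit \<open>s - 1\<close>.
\<close>

definition num_qubits :: "nat \<Rightarrow> nat \<Rightarrow> nat" where
  "num_qubits n d = d + (2 * d + 1) * n"

definition outer_qubits :: "nat \<Rightarrow> nat list" where
  "outer_qubits d = [0..<d]"

definition inner_qubits :: "nat \<Rightarrow> nat \<Rightarrow> nat \<Rightarrow> nat list" where
  "inner_qubits n d s = [d + 2 * n * (s - 1)..<d + 2 * n * s]"

definition system_qubits :: "nat \<Rightarrow> nat \<Rightarrow> nat list" where
  "system_qubits n d = [d + 2 * n * d..<num_qubits n d]"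

definition C_gate :: "nat \<Rightarrow> nat \<Rightarrow> nat \<Rightarrow> complex mat \<Rightarrow> complex mat" where
  "C_gate n d s V = gate_on (num_qubits n d) ((s - 1) # inner_qubits n d s) (controlled V)"

definition SELECT_gate :: "nat \<Rightarrow> nat \<Rightarrow> nat \<Rightarrow> complex mat" where
  "SELECT_gate n d s = gate_on (num_qubits n d) (inner_qubits n d s @ system_qubits n d) (select n)"

definition circuit :: "nat \<Rightarrow> nat \<Rightarrow> complex mat \<Rightarrow> complex mat \<Rightarrow> complex mat \<Rightarrow> complex mat \<Rightarrow> complex mat" where
  "circuit n d P\<^sub>R P\<^sub>L POLY\<^sub>R POLY\<^sub>L =
     (let m = num_qubits n d in
      gate_on m (outer_qubits d) (mat_adjoint POLY\<^sub>L)
      * mat_prod (2 ^ m) (map (\<lambda>s. C_gate n d s (mat_adjoint P\<^sub>L)) [1..<d + 1])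
      * mat_prod (2 ^ m) (map (\<lambda>s. SELECT_gate n d s) (rev [1..<d + 1]))
      * mat_prod (2 ^ m) (map (\<lambda>s. C_gate n d s P\<^sub>R) (rev [1..<d + 1]))
      * gate_on m (outer_qubits d) POLY\<^sub>R)"


section \<open>Checks of the encoding\<close>

lemma tensor_mats_carrier:
  assumes "\<forall>A \<in> set As. A \<in> carrier_mat 2 2"
  shows "tensor_mats As \<in> carrier_mat (2 ^ length As) (2 ^ length As)"
  using assms
proof (induction As)
  case Nil
  show ?case by (simp add: tensor_mats_def)
next
  case (Cons A As)
  have A: "dim_row A = 2" "dim_col A = 2" using Cons.prems by auto
  have As: "tensor_mats As \<in> carrier_mat (2 ^ length As) (2 ^ length As)"
    using Cons.IH Cons.prems by (metis list.set_intros(2))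
  have "tensor_mats (A # As) = A \<otimes>\<^sub>m tensor_mats As" by (simp add: tensor_mats_def)
  moreover have "dim_row (A \<otimes>\<^sub>m tensor_mats As) = 2 * 2 ^ length As"
    unfolding tensor_mat_def dim_row_mat carrier_matD[OF As] A ..
  moreover have "dim_col (A \<otimes>\<^sub>m tensor_mats As) = 2 * 2 ^ length As"
    unfolding tensor_mat_def dim_col_mat carrier_matD[OF As] A ..
  ultimately show ?case by (intro carrier_matI) (simp_all only: list.size power_Suc add_Suc_right add_0_right)
qed

lemma pauli_carrier: "pauli_X \<in> carrier_mat 2 2" "pauli_Z \<in> carrier_mat 2 2"
  unfolding pauli_X_def pauli_Z_def mat_of_rows_list_def by (simp_all add: carrier_matI)

lemma pauli_string_carrier [simp]: "pauli_string n i j \<in> carrier_mat (2 ^ n) (2 ^ n)"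
proof -
  let ?L = "map (\<lambda>l. (pauli_Z ^\<^sub>m qbit n j l) * (pauli_X ^\<^sub>m qbit n i l)) [0..<n]"
  have "\<forall>A \<in> set ?L. A \<in> carrier_mat 2 2"
    using pauli_carrier by (auto intro!: mult_carrier_mat pow_carrier_mat)
  then have "tensor_mats ?L \<in> carrier_mat (2 ^ length ?L) (2 ^ length ?L)"
    by (rule tensor_mats_carrier)
  moreover have "length ?L = n" by simp
  ultimately show ?thesis by (simp only: pauli_string_def)
qed

lemma block_index_less:
  fixes i k M K :: nat
  assumes "i < K" "k < M"
  shows "i * M + k < K * M"
proof -
  have "i * M + k < Suc i * M" using assms by simp
  also have "\<dots> \<le> K * M" using assms by (intro mult_le_mono1) simp
  finally show ?thesis .
qed

lemma div_mod_eq_iff: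
  fixes k i j M :: nat
  assumes "j < M"
  shows "k = i * M + j \<longleftrightarrow> k div M = i \<and> k mod M = j"
  using assms by (auto simp: div_mult_mod_eq)

lemma tensor_ket_ket:
  assumes "i < 2 ^ m" "j < 2 ^ n"
  shows "ket m i \<otimes>\<^sub>v ket n j = ket (m + n) (i * 2 ^ n + j)"
proof (rule eq_vecI)
  fix k assume "k < dim_vec (ket (m + n) (i * 2 ^ n + j))"
  then have k: "k < 2 ^ m * 2 ^ n" by (simp add: ket_def power_add)
  then have "k div 2 ^ n < 2 ^ m" by (simp add: less_mult_imp_div_less)
  then show "(ket m i \<otimes>\<^sub>v ket n j) $ k = ket (m + n) (i * 2 ^ n + j) $ k"
    using k div_mod_eq_iff[OF assms(2), of k i]
    by (auto simp: ket_def tensor_vec_def unit_vec_def power_add)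
qed (simp add: ket_def tensor_vec_def power_add)

lemma qbit_Suc:
  assumes "q < m"
  shows "qbit (Suc m) x (Suc q) = qbit m (x mod 2 ^ m) q"
proof -
  have m: "m = (m - 1 - q) + Suc q" using assms by simp
  have "x mod 2 ^ m div 2 ^ (m - 1 - q) = x div 2 ^ (m - 1 - q) mod 2 ^ Suc q"
    by (subst (1) m, simp only: power_add mod_mult2_eq) simp
  then show ?thesis by (simp add: qbit_def mod_mod_cancel)
qed

lemma ket_eq_tensor_bits:
  assumes "x < 2 ^ m"
  shows "ket m x = tensor_vecs (map (\<lambda>q. ket 1 (qbit m x q)) [0..<m])"
  using assms
proof (induction m arbitrary: x)
  case 0
  then show ?case by (auto simp: ket_def tensor_vecs_def unit_vec_def)
next
  case (Suc m)
  have d: "x div 2 ^ m < 2" using Suc.prems by (simp add: less_mult_imp_div_less)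
  have q0: "qbit (Suc m) x 0 = x div 2 ^ m" using d by (simp add: qbit_def)
  have "tensor_vecs (map (\<lambda>q. ket 1 (qbit (Suc m) x q)) [0..<Suc m])
      = ket 1 (x div 2 ^ m) \<otimes>\<^sub>v tensor_vecs (map (\<lambda>q. ket 1 (qbit (Suc m) x (Suc q))) [0..<m])"
    by (simp only: upt_conv_Cons[OF zero_less_Suc] map_Suc_upt[symmetric])
      (simp add: tensor_vecs_def q0 o_def)
  also have "map (\<lambda>q. ket 1 (qbit (Suc m) x (Suc q))) [0..<m]
      = map (\<lambda>q. ket 1 (qbit m (x mod 2 ^ m) q)) [0..<m]"
    by (simp add: qbit_Suc)
  also have "tensor_vecs \<dots> = ket m (x mod 2 ^ m)"
    by (rule Suc.IH[symmetric]) simp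
  also have "ket 1 (x div 2 ^ m) \<otimes>\<^sub>v ket m (x mod 2 ^ m) = ket (Suc m) x"
    using tensor_ket_ket[of "x div 2 ^ m" 1 "x mod 2 ^ m" m] d by (simp add: div_mult_mod_eq)
  finally show ?case by simp
qed

lemma tensor_vec_assoc: "(u \<otimes>\<^sub>v v) \<otimes>\<^sub>v w = u \<otimes>\<^sub>v v \<otimes>\<^sub>v w"
proof (rule eq_vecI)
  fix k assume "k < dim_vec (u \<otimes>\<^sub>v v \<otimes>\<^sub>v w)"
  then have k: "k < dim_vec u * (dim_vec v * dim_vec w)" by (simp add: tensor_vec_def)
  then have "0 < dim_vec v" "0 < dim_vec w" by (auto intro!: Nat.gr0I)
  moreover have "k div dim_vec w < dim_vec u * dim_vec v"
    using k by (simp add: less_mult_imp_div_less mult.assoc)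
  moreover have "k mod (dim_vec v * dim_vec w) div dim_vec w = k div dim_vec w mod dim_vec v"
    using div_mult_self4[of "dim_vec w" "k div dim_vec w mod dim_vec v" "k mod dim_vec w"] \<open>0 < dim_vec w\<close>
    by (simp only: mult.commute[of "dim_vec v"] mod_mult2_eq) simp
  moreover have "k mod (dim_vec v * dim_vec w) mod dim_vec w = k mod dim_vec w"
    by (simp add: mod_mod_cancel)
  ultimately show "((u \<otimes>\<^sub>v v) \<otimes>\<^sub>v w) $ k = (u \<otimes>\<^sub>v v \<otimes>\<^sub>v w) $ k"
    using k by (simp add: tensor_vec_def mult.assoc div_mult2_eq mult.commute[of "dim_vec v"])
qed (simp add: tensor_vec_def mult.assoc)

lemma select_ket:
  assumes i: "i < 2 ^ n" and j: "j < 2 ^ n" and \<phi>: "\<phi> \<in> carrier_vec (2 ^ n)"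
  shows "select n *\<^sub>v (ket n i \<otimes>\<^sub>v ket n j \<otimes>\<^sub>v \<phi>)
           = ket n i \<otimes>\<^sub>v ket n j \<otimes>\<^sub>v (pauli_string n i j *\<^sub>v \<phi>)"
proof -
  define N :: nat where "N = 2 ^ n"
  define b where "b = i * N + j"
  have N: "0 < N" and N3: "2 ^ (3 * n) = N * N * N" and N2: "2 ^ (n + n) = N * N"
    by (simp_all add: N_def power_add[symmetric] mult_2[symmetric])
  have b: "b < N * N" using i j unfolding b_def N_def by (metis block_index_less)
  have bd: "b div N = i" "b mod N = j" using j by (auto simp: b_def N_def)
  have split: "ket n i \<otimes>\<^sub>v ket n j \<otimes>\<^sub>v v = vec (N * N * N) (\<lambda>y. if y div N = b then v $ (y mod N) else 0)"
    if "v \<in> carrier_vec N" for v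
    using that b N
  proof -
    have "ket n i \<otimes>\<^sub>v ket n j = unit_vec (N * N) b"
      by (simp only: tensor_ket_ket[OF i j]) (simp only: ket_def N2 b_def N_def)
    moreover have "unit_vec (N * N) b \<otimes>\<^sub>v v = vec (N * N * N) (\<lambda>y. if y div N = b then v $ (y mod N) else 0)"
    proof (rule eq_vecI)
      fix y assume "y < dim_vec (vec (N * N * N) (\<lambda>y. if y div N = b then v $ (y mod N) else 0))"
      then have y: "y < N * N * N" by simp
      then have "y div N < N * N" by (simp add: less_mult_imp_div_less)
      then show "(unit_vec (N * N) b \<otimes>\<^sub>v v) $ y
          = vec (N * N * N) (\<lambda>y. if y div N = b then v $ (y mod N) else 0) $ y"
        using y b that by (simp add: tensor_vec_def)
    qed (use that in \<open>simp add: tensor_vec_def\<close>)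
    ultimately show ?thesis by (simp only: tensor_vec_assoc[symmetric])
  qed
  have P: "pauli_string n i j \<in> carrier_mat N N" by (simp add: N_def)
  have \<phi>': "\<phi> \<in> carrier_vec N" using \<phi> by (simp add: N_def)
  show ?thesis
    unfolding split[OF \<phi>'] split[OF mult_mat_vec_carrier[OF P \<phi>']]
  proof (rule eq_vecI)
    let ?t = "vec (N * N * N) (\<lambda>y. if y div N = b then \<phi> $ (y mod N) else 0)"
    fix x assume "x < dim_vec (vec (N * N * N) (\<lambda>y. if y div N = b then (pauli_string n i j *\<^sub>v \<phi>) $ (y mod N) else 0))"
    then have x: "x < N * N * N" by simp
    let ?P = "\<lambda>b. pauli_string n (b div N) (b mod N)"
    have "(select n *\<^sub>v ?t) $ x = (\<Sum>y<N * N * N. if x div N = y div N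
        then ?P (x div N) $$ (x mod N, y mod N) * ?t $ y else 0)"
      using x by (auto simp: select_def Let_def N3 N_def[symmetric] scalar_prod_def
          atLeast0LessThan intro!: sum.cong)
    also have "\<dots> = (\<Sum>y \<in> (\<lambda>r. b * N + r) ` {..<N}. if x div N = b
        then pauli_string n i j $$ (x mod N, y mod N) * \<phi> $ (y mod N) else 0)"
    proof (rule sum.mono_neutral_cong_right)
      show "(\<lambda>r. b * N + r) ` {..<N} \<subseteq> {..<N * N * N}"
        using b by (auto intro: block_index_less)
      show "\<forall>y \<in> {..<N * N * N} - (\<lambda>r. b * N + r) ` {..<N}. (if x div N = y div N
        then ?P (x div N) $$ (x mod N, y mod N) * ?t $ y else 0) = 0"
      proof
        fix y assume y: "y \<in> {..<N * N * N} - (\<lambda>r. b * N + r) ` {..<N}"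
        have "y div N \<noteq> b"
          using y N by (metis DiffD2 div_mult_mod_eq image_eqI lessThan_iff mod_less_divisor)
        then show "(if x div N = y div N
          then ?P (x div N) $$ (x mod N, y mod N) * ?t $ y else 0) = 0"
          using y by auto
      qed
    next
      fix y assume "y \<in> (\<lambda>r. b * N + r) ` {..<N}"
      then obtain r where r: "y = b * N + r" "r < N" by auto
      have "y < N * N * N" using r b by (metis block_index_less)
      then show "(if x div N = y div N then ?P (x div N) $$ (x mod N, y mod N) * ?t $ y else 0)
        = (if x div N = b then pauli_string n i j $$ (x mod N, y mod N) * \<phi> $ (y mod N) else 0)"
        using r bd by auto
    qed simp
    also have "\<dots> = (if x div N = b then (\<Sum>r<N. pauli_string n i j $$ (x mod N, r) * \<phi> $ r) else 0)"
      by (subst sum.reindex) (auto simp: inj_on_def)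
    also have "\<dots> = (if x div N = b then (pauli_string n i j *\<^sub>v \<phi>) $ (x mod N) else 0)"
      using P \<phi>' N by (auto simp: scalar_prod_def atLeast0LessThan intro!: sum.cong)
    finally show "(select n *\<^sub>v ?t) $ x = vec (N * N * N) (\<lambda>y. if y div N = b
        then (pauli_string n i j *\<^sub>v \<phi>) $ (y mod N) else 0) $ x"
      using x by simp
  qed (simp add: select_def N3)
qed

lemma pauli_string_Suc:
  assumes "i < 2 ^ Suc n" "j < 2 ^ Suc n"
  shows "pauli_string (Suc n) i j = ((pauli_Z ^\<^sub>m (j div 2 ^ n)) * (pauli_X ^\<^sub>m (i div 2 ^ n)))
           \<otimes>\<^sub>m pauli_string n (i mod 2 ^ n) (j mod 2 ^ n)"
proof -
  have "i div 2 ^ n < 2" "j div 2 ^ n < 2" using assms by (simp_all add: less_mult_imp_div_less)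
  then have q: "qbit (Suc n) i 0 = i div 2 ^ n" "qbit (Suc n) j 0 = j div 2 ^ n"
    by (simp_all add: qbit_def)
  let ?g = "\<lambda>l. (pauli_Z ^\<^sub>m qbit (Suc n) j l) * (pauli_X ^\<^sub>m qbit (Suc n) i l)"
  have "map ?g [0..<Suc n] = ?g 0 # map (\<lambda>l. ?g (Suc l)) [0..<n]"
    by (simp only: upt_conv_Cons[OF zero_less_Suc] map_Suc_upt[symmetric]) simp
  also have "map (\<lambda>l. ?g (Suc l)) [0..<n]
    = map (\<lambda>l. (pauli_Z ^\<^sub>m qbit n (j mod 2 ^ n) l) * (pauli_X ^\<^sub>m qbit n (i mod 2 ^ n) l)) [0..<n]"
    by (simp add: qbit_Suc)
  finally show ?thesis
    by (simp only: pauli_string_def tensor_mats_def foldr.simps o_apply q)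
qed

lemma pauli_pow: "k < 2 \<Longrightarrow> pauli_X ^\<^sub>m k = (if k = 0 then 1\<^sub>m 2 else pauli_X)"
  "k < 2 \<Longrightarrow> pauli_Z ^\<^sub>m k = (if k = 0 then 1\<^sub>m 2 else pauli_Z)"
  using pauli_carrier by (auto dest!: less_2_cases)

lemma pauli_entry:
  assumes "i < 2" "j < 2" "r < 2" "c < 2"
  shows "((pauli_Z ^\<^sub>m j) * (pauli_X ^\<^sub>m i)) $$ (r, c)
    = (if (r + c) mod 2 = i then if j = 1 \<and> r = 1 then - 1 else 1 else 0)"
proof -
  have Z: "(pauli_Z ^\<^sub>m j) $$ (r, k) = (if r = k then if j = 1 \<and> r = 1 then - 1 else 1 else 0)"
    if "k < 2" for k
    using assms that unfolding pauli_pow(2)[OF assms(2)] pauli_Z_def mat_of_rows_list_def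
    by (auto dest!: less_2_cases)
  have X: "(pauli_X ^\<^sub>m i) $$ (k, c) = (if (k + c) mod 2 = i then 1 else 0)" if "k < 2" for k
    using assms that unfolding pauli_pow(1)[OF assms(1)] pauli_X_def mat_of_rows_list_def
    by (auto dest!: less_2_cases)
  have "((pauli_Z ^\<^sub>m j) * (pauli_X ^\<^sub>m i)) $$ (r, c)
      = (\<Sum>k<2. (pauli_Z ^\<^sub>m j) $$ (r, k) * (pauli_X ^\<^sub>m i) $$ (k, c))"
    using carrier_matD[OF pow_carrier_mat[OF pauli_carrier(2), of j]]
      carrier_matD[OF pow_carrier_mat[OF pauli_carrier(1), of i]] assms
    by (simp add: scalar_prod_def atLeast0LessThan)
  also have "\<dots> = (\<Sum>k<2. if r = k then (if j = 1 \<and> r = 1 then - 1 else 1)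
      * (if (k + c) mod 2 = i then 1 else 0) else 0)"
    by (rule sum.cong) (simp_all add: Z X)
  also have "\<dots> = (if (r + c) mod 2 = i then if j = 1 \<and> r = 1 then - 1 else 1 else 0)"
    using assms(3) by (subst sum.delta') auto
  finally show ?thesis .
qed

lemma sum_lessThan_double:
  fixes f :: "nat \<Rightarrow> complex"
  shows "(\<Sum>i<2 * M. f i) = (\<Sum>i<M. f i) + (\<Sum>i<M. f (M + i))"
proof -
  have "(\<Sum>i<2 * M. f i) = (\<Sum>i<M. f i) + (\<Sum>i\<in>{M..<2 * M}. f i)"
    by (simp add: lessThan_atLeast0 sum.atLeastLessThan_concat)
  also have "(\<Sum>i\<in>{M..<2 * M}. f i) = (\<Sum>i<M. f (M + i))"
    using sum.shift_bounds_nat_ivl[of f 0 M M]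
    by (simp add: lessThan_atLeast0 mult_2 add.commute)
  finally show ?thesis .
qed

lemma pauli_decomposition_entries:
  "\<exists>\<alpha>. \<forall>r<2 ^ n. \<forall>c<2 ^ n.
     h r c = (\<Sum>i<2 ^ n. \<Sum>j<2 ^ n. \<alpha> i j * pauli_string n i j $$ (r, c))"
proof (induction n arbitrary: h)
  case 0
  have "pauli_string 0 0 0 = 1\<^sub>m 1" by (simp add: pauli_string_def tensor_mats_def)
  then have "h r c = (\<Sum>i<1. \<Sum>j<1. h 0 0 * pauli_string 0 i j $$ (r, c))" if "r < 1" "c < 1" for r c
    using that by simp
  then show ?case unfolding power_0 by (intro exI[of _ "\<lambda>_ _. h 0 0"] allI impI)
next
  case (Suc n)
  define M :: nat where "M = 2 ^ n"
  have M: "0 < M" "2 ^ Suc n = 2 * M" by (simp_all add: M_def)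
  define b where "b i0 j0 r c =
    (let s = if j0 = (0::nat) then 1 else - 1 in
     if i0 = (0::nat) then (h r c + s * h (M + r) (M + c)) / 2
     else (h r (M + c) + s * h (M + r) c) / 2)" for i0 j0 r c
  have "\<forall>i0 j0. \<exists>\<beta>. \<forall>r<M. \<forall>c<M.
      b i0 j0 r c = (\<Sum>i<M. \<Sum>j<M. \<beta> i j * pauli_string n i j $$ (r, c))"
    unfolding M_def by (intro allI) (rule Suc.IH)
  then obtain \<beta> where "\<forall>i0 j0. \<forall>r<M. \<forall>c<M.
      b i0 j0 r c = (\<Sum>i<M. \<Sum>j<M. \<beta> i0 j0 i j * pauli_string n i j $$ (r, c))"
    unfolding choice_iff ..
  then have \<beta>: "(\<Sum>i<M. \<Sum>j<M. \<beta> i0 j0 i j * pauli_string n i j $$ (r, c)) = b i0 j0 r c"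
    if "r < M" "c < M" for i0 j0 r c
    using that by simp
  define \<alpha> where "\<alpha> i j = \<beta> (i div M) (j div M) (i mod M) (j mod M)" for i j
  show ?case
  proof (intro exI[of _ \<alpha>] allI impI)
    fix r c :: nat assume "r < 2 ^ Suc n" "c < 2 ^ Suc n"
    then have rc: "r < 2 * M" "c < 2 * M" by (simp_all add: M_def)
    define r0 c0 r' c' where d: "r0 = r div M" "c0 = c div M" "r' = r mod M" "c' = c mod M"
    have r0: "r0 < 2" "c0 < 2" and r': "r' < M" "c' < M"
      using rc M by (simp_all add: d less_mult_imp_div_less)
    have r: "r = r0 * M + r'" "c = c0 * M + c'" by (simp_all add: d div_mult_mod_eq)
    define G where "G i j = ((pauli_Z ^\<^sub>m j) * (pauli_X ^\<^sub>m i)) $$ (r0, c0)" for i j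
    have G: "G i j = (if (r0 + c0) mod 2 = i then if j = 1 \<and> r0 = 1 then - 1 else 1 else 0)"
      if "i < 2" "j < 2" for i j
      unfolding G_def by (rule pauli_entry[OF that r0])
    have P: "\<alpha> (i0 * M + i) (j0 * M + j) * pauli_string (Suc n) (i0 * M + i) (j0 * M + j) $$ (r, c)
        = G i0 j0 * (\<beta> i0 j0 i j * pauli_string n i j $$ (r', c'))"
      if "i0 < 2" "j0 < 2" "i < M" "j < M" for i0 j0 i j
    proof -
      have l: "i0 * M + i < 2 ^ Suc n" "j0 * M + j < 2 ^ Suc n"
        unfolding M(2) using that by (auto intro: block_index_less)
      have dm: "(i0 * M + i) div M = i0" "(i0 * M + i) mod M = i"
        "(j0 * M + j) div M = j0" "(j0 * M + j) mod M = j"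
        using div_mod_eq_iff[OF that(3), of "i0 * M + i" i0] div_mod_eq_iff[OF that(4), of "j0 * M + j" j0]
        by blast+
      let ?A = "(pauli_Z ^\<^sub>m j0) * (pauli_X ^\<^sub>m i0)"
      have A: "dim_row ?A = 2" "dim_col ?A = 2"
        using carrier_matD[OF pow_carrier_mat[OF pauli_carrier(2), of j0]]
          carrier_matD[OF pow_carrier_mat[OF pauli_carrier(1), of i0]] by simp_all
      have B: "dim_row (pauli_string n i j) = M" "dim_col (pauli_string n i j) = M"
        using carrier_matD[OF pauli_string_carrier[of n i j]] by (simp_all add: M_def)
      have "pauli_string (Suc n) (i0 * M + i) (j0 * M + j) $$ (r, c)
          = (?A \<otimes>\<^sub>m pauli_string n i j) $$ (r, c)"
        unfolding pauli_string_Suc[OF l, folded M_def, unfolded dm] ..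
      also have "\<dots> = G i0 j0 * pauli_string n i j $$ (r', c')"
        unfolding tensor_mat_def A B G_def d using rc by (simp add: index_mat)
      finally show ?thesis unfolding \<alpha>_def dm by (simp add: mult.left_commute)
    qed
    let ?f = "\<lambda>i j. \<alpha> i j * pauli_string (Suc n) i j $$ (r, c)"
    have blk: "(\<Sum>i<M. \<Sum>j<M. ?f (i0 * M + i) (j0 * M + j)) = G i0 j0 * b i0 j0 r' c'"
      if "i0 < 2" "j0 < 2" for i0 j0
      by (simp add: P[OF that] sum_distrib_left[symmetric] \<beta>[OF r'])
    have "(\<Sum>i<2 ^ Suc n. \<Sum>j<2 ^ Suc n. ?f i j)
        = (\<Sum>i<M. \<Sum>j<M. ?f i j) + (\<Sum>i<M. \<Sum>j<M. ?f i (M + j))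
        + ((\<Sum>i<M. \<Sum>j<M. ?f (M + i) j) + (\<Sum>i<M. \<Sum>j<M. ?f (M + i) (M + j)))"
      unfolding M(2) sum_lessThan_double sum.distrib by (simp only: ac_simps)
    also have "\<dots> = G 0 0 * b 0 0 r' c' + G 0 1 * b 0 1 r' c' + (G 1 0 * b 1 0 r' c' + G 1 1 * b 1 1 r' c')"
      using blk[of 0 0] blk[of 0 1] blk[of 1 0] blk[of 1 1] by simp
    also have "\<dots> = h r c"
      unfolding r using r0
      by (auto dest!: less_2_cases simp: G b_def field_simps)
    finally show "h r c = (\<Sum>i<2 ^ Suc n. \<Sum>j<2 ^ Suc n. ?f i j)" by simp
  qed
qed

lemma pauli_decomposition:
  assumes "H \<in> carrier_mat (2 ^ n) (2 ^ n)"
  shows "\<exists>\<alpha>. H = pauli_sum n \<alpha>"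
proof -
  obtain \<alpha> where \<alpha>: "\<forall>r<2 ^ n. \<forall>c<2 ^ n.
      H $$ (r, c) = (\<Sum>i<2 ^ n. \<Sum>j<2 ^ n. \<alpha> i j * pauli_string n i j $$ (r, c))"
    using pauli_decomposition_entries[of n "\<lambda>r c. H $$ (r, c)"] by blast
  have "H = pauli_sum n \<alpha>"
  proof (rule eq_matI)
    fix r c assume "r < dim_row (pauli_sum n \<alpha>)" "c < dim_col (pauli_sum n \<alpha>)"
    then have rc: "r < 2 ^ n" "c < 2 ^ n" by (simp_all add: pauli_sum_def mat_sum_def)
    have "(\<alpha> i j \<cdot>\<^sub>m pauli_string n i j) $$ (r, c) = \<alpha> i j * pauli_string n i j $$ (r, c)" for i j
      using rc carrier_matD[OF pauli_string_carrier[of n i j]] by (intro index_smult_mat) simp_all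
    then show "H $$ (r, c) = pauli_sum n \<alpha> $$ (r, c)"
      using \<alpha> rc by (simp add: pauli_sum_def mat_sum_def sum.cartesian_product split_beta)
  qed (use assms in \<open>simp_all add: pauli_sum_def mat_sum_def\<close>)
  then show ?thesis by blast
qed

end

theory Submission
  imports Defs
begin

text \<open>
  Expand the state after \<open>POLY\<^sub>R\<close> in the basis of the outer ancillas. On the branch of a basis vector
  \<open>|t\<rangle>\<close> the controlled \<open>P\<^sub>R\<close> put \<open>P\<^sub>R|0\<rangle>\<close> into the inner registers with control bit 1 and leave
  \<open>|0\<rangle>\<close> in the others, on which \<open>SELECT\<close> is trivial because the Pauli string of index \<open>(0, 0)\<close> is the
  identity. A register holding \<open>P\<^sub>R|0\<rangle>\<close> that is finally projected on \<open>P\<^sub>L|0\<rangle>\<close> turns its \<open>SELECT\<close> into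
  \<open>K = \<Sum> \<alpha>\<^sub>i\<^sub>j P\<^sub>i\<^sub>j / N = H / N\<close>, with \<open>P\<^sub>i\<^sub>j\<close> the Pauli strings and \<open>N\<close> the norm of \<open>\<alpha>\<close>. So the
  branch applies \<open>K\<close> as often as \<open>t\<close> has ones, which is \<open>k\<close> times for the unary vector of \<open>k\<close>. The
  projection on the state of \<open>POLY\<^sub>L\<close> weights this branch with \<open>|a\<^sub>k| N\<^sup>k / W\<close> and the telescoping phase
  \<open>arg a\<^sub>k - arg a\<^sub>0\<close>, so the scalar is \<open>exp (- i arg a\<^sub>0) / W\<close>.
\<close>

section \<open>Gates on subsets of the qubits\<close>

lemma qbit_less_2 [simp]: "qbit m x q < 2"
  by (simp add: qbit_def)

lemma qbit_eq_1_iff: "qbit m x q = 1 \<longleftrightarrow> qbit m x q \<noteq> 0"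
  using qbit_less_2[of m x q] by linarith

lemma qbit_zero [simp]: "qbit m 0 q = 0"
  by (simp add: qbit_def)

text \<open>The new bit is the least significant one, hence the last qubit, and all other qubits
  keep their number. \<open>sub_index\<close> grows in the same way, which is why the inductions on
  lists of qubits below run from the right end.\<close>

lemma qbit_append:
  assumes "b < 2" "q < Suc m"
  shows "qbit (Suc m) (2 * x + b) q = (if q = m then b else qbit m x q)"
proof (cases "q = m")
  case False
  then have "2 ^ (m - q) = 2 * (2::nat) ^ (m - 1 - q)"
    using assms by (metis Suc_diff_Suc diff_commute diff_Suc_1 less_SucE power_Suc diff_Suc_eq_diff_pred)
  then show ?thesis
    using False assms by (simp add: qbit_def div_mult2_eq)
qed (use assms in \<open>simp add: qbit_def\<close>)

lemma qbit_eqI: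
  assumes "x < 2 ^ m" "y < 2 ^ m" "\<And>q. q < m \<Longrightarrow> qbit m x q = qbit m y q"
  shows "x = y"
  using assms
proof (induction m arbitrary: x y)
  case (Suc m)
  \<comment> \<open>Every \<open>z\<close> is \<open>2 * (z div 2) + z mod 2\<close>, so its last
    bit can be split off as an appended one.\<close>
  have *: "qbit (Suc m) z m = z mod 2" "q < m \<Longrightarrow> qbit (Suc m) z q = qbit m (z div 2) q" for z q
    using qbit_append[of "z mod 2" m m "z div 2"] qbit_append[of "z mod 2" q m "z div 2"] by auto
  have "x div 2 = y div 2"
  proof (rule Suc.IH)
    fix q assume "q < m"
    then show "qbit m (x div 2) q = qbit m (y div 2) q"
      using Suc.prems(3)[of q] by (simp add: *(2))
  qed (use Suc.prems in auto)
  moreover have "x mod 2 = y mod 2"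
    using Suc.prems(3)[of m] by (simp add: *)
  ultimately show ?case by (metis div_mult_mod_eq)
qed simp

lemma ex_qbits:
  assumes "\<And>q. q < m \<Longrightarrow> f q < 2"
  shows "\<exists>x<2 ^ m. \<forall>q<m. qbit m x q = f q"
  using assms
proof (induction m)
  case (Suc m)
  then obtain x where "x < 2 ^ m" "\<forall>q<m. qbit m x q = f q" by auto
  then show ?case
    using Suc.prems[of m] by (intro exI[of _ "2 * x + f m"]) (auto simp: qbit_append)
qed simp

lemma sub_index_Nil [simp]: "sub_index m [] x = 0"
  and sub_index_snoc [simp]: "sub_index m (qs @ [q]) x = 2 * sub_index m qs x + qbit m x q"
  by (simp_all add: sub_index_def)

lemma sub_index_append:
  "sub_index m (qs @ rs) x = sub_index m qs x * 2 ^ length rs + sub_index m rs x"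
  by (induction rs rule: rev_induct) (simp_all flip: append_assoc)

lemma sub_index_Cons:
  "sub_index m (q # qs) x = qbit m x q * 2 ^ length qs + sub_index m qs x"
  using sub_index_append[of m "[q]" qs x] sub_index_snoc[of m "[]" q x] by simp

lemma sub_index_less: "sub_index m qs x < 2 ^ length qs"
proof (induction qs rule: rev_induct)
  case (snoc q qs)
  then show ?case using qbit_less_2[of m x q] unfolding sub_index_snoc length_append_singleton power_Suc by linarith
qed simp

lemma qbit_sub_index:
  "r < length qs \<Longrightarrow> qbit (length qs) (sub_index m qs x) r = qbit m x (qs ! r)"
  by (induction qs rule: rev_induct) (auto simp: qbit_append nth_append)

lemma sub_index_cong:
  "(\<And>q. q \<in> set qs \<Longrightarrow> qbit m x q = qbit m y q) \<Longrightarrow> sub_index m qs x = sub_index m qs y"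
  by (induction qs rule: rev_induct) auto

lemma sub_index_eq_iff:
  "sub_index m qs x = sub_index m qs y \<longleftrightarrow> (\<forall>q \<in> set qs. qbit m x q = qbit m y q)"
proof
  assume eq: "sub_index m qs x = sub_index m qs y"
  show "\<forall>q \<in> set qs. qbit m x q = qbit m y q"
  proof
    fix q assume "q \<in> set qs"
    then obtain r where "r < length qs" "q = qs ! r" by (auto simp: in_set_conv_nth)
    then show "qbit m x q = qbit m y q"
      using qbit_sub_index[of r qs m x] qbit_sub_index[of r qs m y] eq by simp
  qed
qed (auto intro: sub_index_cong)

lemma sub_index_eq_0_iff: "sub_index m qs x = 0 \<longleftrightarrow> (\<forall>q \<in> set qs. qbit m x q = 0)"
  by (induction qs rule: rev_induct) auto

text \<open>Adjacent qubits occupy a block of binary digits, which \<open>div\<close> and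
  \<open>mod\<close> cut out. This identifies the system register with the low digits of an index
  and the ancillas with the high ones.\<close>

lemma sub_index_upt:
  assumes "a + l \<le> m"
  shows "sub_index m [a..<a + l] x = x div 2 ^ (m - (a + l)) mod 2 ^ l"
  using assms
proof (induction l)
  case (Suc l)
  let ?e = "m - Suc (a + l)"
  have e: "m - (a + l) = Suc ?e" using Suc.prems by simp
  have "sub_index m [a..<a + Suc l] x = 2 * (x div 2 ^ (m - (a + l)) mod 2 ^ l) + x div 2 ^ ?e mod 2"
    using Suc by (simp add: qbit_def)
  also have "\<dots> = x div 2 ^ ?e mod (2 * 2 ^ l)"
    unfolding e mod_mult2_eq by (simp add: div_mult2_eq mult.commute[of 2])
  finally show ?case by simp
qed simp

text \<open>The basis states to which \<open>x\<close> is connected by gates on the qubits \<open>qs\<close>.\<close>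

definition fibre :: "nat \<Rightarrow> nat list \<Rightarrow> nat \<Rightarrow> nat set" where
  "fibre m qs x = {y. y < 2 ^ m \<and> (\<forall>q<m. q \<notin> set qs \<longrightarrow> qbit m x q = qbit m y q)}"

lemma fibre_qbit: "y \<in> fibre m qs x \<Longrightarrow> q < m \<Longrightarrow> q \<notin> set qs \<Longrightarrow> qbit m y q = qbit m x q"
  by (auto simp: fibre_def)

lemma finite_fibre [simp]: "finite (fibre m qs x)"
  by (simp add: fibre_def)

lemma fibre_sub_index:
  assumes "y \<in> fibre m qs x" "set rs \<subseteq> {..<m}" "set rs \<inter> set qs = {}"
  shows "sub_index m rs y = sub_index m rs x"
  using assms by (intro sub_index_cong fibre_qbit) auto

text \<open>On a fibre the bits outside \<open>qs\<close> are frozen and those at \<open>qs\<close>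
  are free, so the sub-index is a coordinate on it. Sums over a fibre thereby become sums over the
  column index of the gate.\<close>

lemma bij_betw_sub_index_fibre:
  assumes "distinct qs" "set qs \<subseteq> {..<m}"
  shows "bij_betw (sub_index m qs) (fibre m qs x) {..<2 ^ length qs}"
proof (rule bij_betw_imageI)
  show "inj_on (sub_index m qs) (fibre m qs x)"
  proof (rule inj_onI)
    fix y z assume *: "y \<in> fibre m qs x" "z \<in> fibre m qs x" "sub_index m qs y = sub_index m qs z"
    show "y = z"
    proof (rule qbit_eqI[of _ m])
      fix q assume "q < m"
      then show "qbit m y q = qbit m z q"
        using * by (cases "q \<in> set qs") (auto simp: sub_index_eq_iff fibre_qbit)
    qed (use * in \<open>auto simp: fibre_def\<close>)
  qed
  show "sub_index m qs ` fibre m qs x = {..<2 ^ length qs}"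
  proof (intro equalityI subsetI)
    fix t :: nat assume t: "t \<in> {..<2 ^ length qs}"
    \<comment> \<open>The bits of a preimage of \<open>t\<close>: at a qubit of \<open>qs\<close>
      the bit of \<open>t\<close> at its position, which is unique by distinctness, and elsewhere
      the bit of \<open>x\<close>.\<close>
    define f where "f q = (if q \<in> set qs then qbit (length qs) t (THE r. r < length qs \<and> qs ! r = q)
      else qbit m x q)" for q
    have "f q < 2" for q by (simp add: f_def)
    then obtain y where y: "y < 2 ^ m" "\<forall>q<m. qbit m y q = f q"
      using ex_qbits[of m f] by blast
    have f: "f (qs ! r) = qbit (length qs) t r" if "r < length qs" for r
    proof -
      have "(THE r'. r' < length qs \<and> qs ! r' = qs ! r) = r"
        using that assms(1) by (auto simp: nth_eq_iff_index_eq)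
      then show ?thesis using that by (simp add: f_def)
    qed
    have "sub_index m qs y = t"
    proof (rule qbit_eqI[of _ "length qs"])
      fix r assume r: "r < length qs"
      then have "qs ! r < m" using assms(2) nth_mem[of r qs] by blast
      then show "qbit (length qs) (sub_index m qs y) r = qbit (length qs) t r"
        using r y by (simp add: qbit_sub_index f)
    qed (use t in \<open>auto simp: sub_index_less\<close>)
    moreover have "y \<in> fibre m qs x" using y by (simp add: fibre_def f_def)
    ultimately show "t \<in> sub_index m qs ` fibre m qs x" by blast
  qed (auto simp: sub_index_less)
qed

lemma sum_fibre:
  fixes g :: "nat \<Rightarrow> 'a::comm_monoid_add"
  assumes "distinct qs" "set qs \<subseteq> {..<m}"
  shows "(\<Sum>y \<in> fibre m qs x. g (sub_index m qs y)) = (\<Sum>t<2 ^ length qs. g t)"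
  by (rule sum.reindex_bij_betw[OF bij_betw_sub_index_fibre[OF assms]])

lemma gate_on_carrier [simp]: "gate_on m qs V \<in> carrier_mat (2 ^ m) (2 ^ m)"
  by (simp add: gate_on_def)

lemma gate_on_mult_vec:
  assumes "v \<in> carrier_vec (2 ^ m)" "x < 2 ^ m"
  shows "(gate_on m qs V *\<^sub>v v) $ x
    = (\<Sum>y \<in> fibre m qs x. V $$ (sub_index m qs x, sub_index m qs y) * v $ y)"
proof -
  have "(gate_on m qs V *\<^sub>v v) $ x = (\<Sum>y<2 ^ m. (if \<forall>q<m. q \<notin> set qs \<longrightarrow> qbit m x q = qbit m y q
      then V $$ (sub_index m qs x, sub_index m qs y) else 0) * v $ y)"
    using assms by (auto simp: gate_on_def scalar_prod_def atLeast0LessThan intro!: sum.cong)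
  also have "\<dots> = (\<Sum>y \<in> fibre m qs x. V $$ (sub_index m qs x, sub_index m qs y) * v $ y)"
    by (rule sum.mono_neutral_cong_right) (auto simp: fibre_def)
  finally show ?thesis .
qed

text \<open>The vector \<open>w\<close> may change with \<open>x\<close>: it describes
  \<open>v\<close> on the fibre of \<open>x\<close> only, with the amplitudes of the untouched
  qubits absorbed as a scalar. This is how gates are evaluated on states with factored
  amplitudes.\<close>

lemma gate_on_mult_vec_local:
  assumes "distinct qs" "set qs \<subseteq> {..<m}" "V \<in> carrier_mat (2 ^ length qs) (2 ^ length qs)"
    and "v \<in> carrier_vec (2 ^ m)" "x < 2 ^ m" "w \<in> carrier_vec (2 ^ length qs)"
    and "\<And>y. y \<in> fibre m qs x \<Longrightarrow> v $ y = w $ sub_index m qs y"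
  shows "(gate_on m qs V *\<^sub>v v) $ x = (V *\<^sub>v w) $ sub_index m qs x"
proof -
  have "(gate_on m qs V *\<^sub>v v) $ x
      = (\<Sum>y \<in> fibre m qs x. V $$ (sub_index m qs x, sub_index m qs y) * w $ sub_index m qs y)"
    using assms by (simp add: gate_on_mult_vec)
  also have "\<dots> = (\<Sum>t<2 ^ length qs. V $$ (sub_index m qs x, t) * w $ t)"
    by (rule sum_fibre[OF assms(1,2)])
  also have "\<dots> = (V *\<^sub>v w) $ sub_index m qs x"
    using assms(3,6) sub_index_less[of m qs x]
    by (auto simp: scalar_prod_def atLeast0LessThan intro!: sum.cong)
  finally show ?thesis .
qed

text \<open>Terms with another value at \<open>qs\<close> vanish, and what is left of the fibre
  along \<open>qs @ rs\<close> is the fibre along \<open>rs\<close>. The controlled gates and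
  \<open>SELECT\<close> are the two instances, with blocks indexed by the control bit and by the
  value of the inner register.\<close>

lemma gate_on_block_diagonal:
  assumes "distinct (qs @ rs)" "set (qs @ rs) \<subseteq> {..<m}"
    and V: "\<And>b c i j. b < 2 ^ length qs \<Longrightarrow> c < 2 ^ length qs \<Longrightarrow> i < 2 ^ length rs \<Longrightarrow> j < 2 ^ length rs
      \<Longrightarrow> V $$ (b * 2 ^ length rs + i, c * 2 ^ length rs + j) = (if b = c then F b $$ (i, j) else 0)"
    and v: "v \<in> carrier_vec (2 ^ m)" and x: "x < 2 ^ m"
  shows "(gate_on m (qs @ rs) V *\<^sub>v v) $ x = (gate_on m rs (F (sub_index m qs x)) *\<^sub>v v) $ x"
proof -
  have "(gate_on m (qs @ rs) V *\<^sub>v v) $ x = (\<Sum>y \<in> fibre m (qs @ rs) x.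
      (if sub_index m qs x = sub_index m qs y then F (sub_index m qs x) $$ (sub_index m rs x, sub_index m rs y)
       else 0) * v $ y)"
    using v x by (simp add: gate_on_mult_vec sub_index_append V sub_index_less)
  also have "\<dots> = (\<Sum>y \<in> fibre m rs x. F (sub_index m qs x) $$ (sub_index m rs x, sub_index m rs y) * v $ y)"
    by (rule sum.mono_neutral_cong_right)
      (use assms(1,2) in \<open>auto simp: fibre_def sub_index_eq_iff\<close>)
  also have "\<dots> = (gate_on m rs (F (sub_index m qs x)) *\<^sub>v v) $ x"
    using v x by (simp add: gate_on_mult_vec)
  finally show ?thesis .
qed

lemma gate_on_one_mult_vec:
  assumes "distinct qs" "set qs \<subseteq> {..<m}" "v \<in> carrier_vec (2 ^ m)" "x < 2 ^ m"
  shows "(gate_on m qs (1\<^sub>m (2 ^ length qs)) *\<^sub>v v) $ x = v $ x"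
proof -
  have "inj_on (sub_index m qs) (fibre m qs x)"
    using bij_betw_sub_index_fibre[OF assms(1,2)] by (rule bij_betw_imp_inj_on)
  moreover have "x \<in> fibre m qs x" using assms(4) by (simp add: fibre_def)
  ultimately have "sub_index m qs x = sub_index m qs y \<longleftrightarrow> x = y" if "y \<in> fibre m qs x" for y
    using that by (auto dest: inj_onD)
  then have "(gate_on m qs (1\<^sub>m (2 ^ length qs)) *\<^sub>v v) $ x = (\<Sum>y \<in> fibre m qs x. if x = y then v $ y else 0)"
    unfolding gate_on_mult_vec[OF assms(3,4)]
    by (intro sum.cong) (simp_all add: sub_index_less)
  then show ?thesis using \<open>x \<in> fibre m qs x\<close> by simp
qed

lemma gate_on_controlled:
  assumes "distinct (q # qs)" "set (q # qs) \<subseteq> {..<m}" "V \<in> carrier_mat (2 ^ length qs) (2 ^ length qs)"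
    and "v \<in> carrier_vec (2 ^ m)" "x < 2 ^ m"
  shows "(gate_on m (q # qs) (controlled V) *\<^sub>v v) $ x
    = (if qbit m x q = 0 then v $ x else (gate_on m qs V *\<^sub>v v) $ x)"
proof -
  let ?F = "\<lambda>b. if b = 0 then 1\<^sub>m (2 ^ length qs) else V"
  have "(gate_on m ([q] @ qs) (controlled V) *\<^sub>v v) $ x = (gate_on m qs (?F (sub_index m [q] x)) *\<^sub>v v) $ x"
  proof (rule gate_on_block_diagonal)
    fix b c i j :: nat
    assume *: "b < 2 ^ length [q]" "c < 2 ^ length [q]" "i < 2 ^ length qs" "j < 2 ^ length qs"
    then have "b = 0 \<or> b = 1" "c = 0 \<or> c = 1" by auto
    then show "controlled V $$ (b * 2 ^ length qs + i, c * 2 ^ length qs + j)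
        = (if b = c then ?F b $$ (i, j) else 0)"
      using *(3,4) assms(3) by (auto simp: controlled_def Let_def)
  qed (use assms in auto)
  then show ?thesis
    using assms by (simp add: sub_index_Cons gate_on_one_mult_vec)
qed

lemma gate_on_select:
  assumes "distinct (qs @ rs)" "set (qs @ rs) \<subseteq> {..<m}" "length qs = 2 * n" "length rs = n"
    and "v \<in> carrier_vec (2 ^ m)" "x < 2 ^ m"
  shows "(gate_on m (qs @ rs) (select n) *\<^sub>v v) $ x
    = (gate_on m rs (pauli_string n (sub_index m qs x div 2 ^ n) (sub_index m qs x mod 2 ^ n)) *\<^sub>v v) $ x"
proof (rule gate_on_block_diagonal)
  fix b c i j :: nat
  assume *: "b < 2 ^ length qs" "c < 2 ^ length qs" "i < 2 ^ length rs" "j < 2 ^ length rs"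
  have "b * 2 ^ n + i < 2 ^ (2 * n) * 2 ^ n" "c * 2 ^ n + j < 2 ^ (2 * n) * 2 ^ n"
    using * assms(3,4) by (auto intro: block_index_less)
  then have "b * 2 ^ n + i < 2 ^ (3 * n)" "c * 2 ^ n + j < 2 ^ (3 * n)"
    by (simp_all flip: power_add)
  then show "select n $$ (b * 2 ^ length rs + i, c * 2 ^ length rs + j)
      = (if b = c then pauli_string n (b div 2 ^ n) (b mod 2 ^ n) $$ (i, j) else 0)"
    using * assms(3,4) by (auto simp: select_def)
qed (use assms in auto)


section \<open>Products of operators and Pauli blocks\<close>

lemma mat_prod_carrier:
  assumes "\<And>A. A \<in> set As \<Longrightarrow> A \<in> carrier_mat N N"
  shows "mat_prod N As \<in> carrier_mat N N"
  using assms by (induction As) (auto simp: mat_prod_def intro: mult_carrier_mat)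

lemma mat_prod_Nil_mult_vec: "v \<in> carrier_vec N \<Longrightarrow> mat_prod N [] *\<^sub>v v = v"
  by (simp add: mat_prod_def)

lemma mat_prod_Cons_mult_vec:
  assumes "\<And>B. B \<in> set (A # As) \<Longrightarrow> B \<in> carrier_mat N N" "v \<in> carrier_vec N"
  shows "mat_prod N (A # As) *\<^sub>v v = A *\<^sub>v (mat_prod N As *\<^sub>v v)"
proof -
  have "mat_prod N (A # As) = A * mat_prod N As" by (simp add: mat_prod_def)
  then show ?thesis
    using assms mat_prod_carrier[of As N] by (metis assoc_mult_mat_vec list.set_intros)
qed

lemma rev_upt_Suc: "rev [1..<Suc l + 1] = Suc l # rev [1..<l + 1]"
  by simp

lemma mult_smult_mult_vec_index:
  fixes A :: "complex mat"
  assumes "A \<in> carrier_mat N M" "v \<in> carrier_vec M" "i < N"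
  shows "(A *\<^sub>v (c \<cdot>\<^sub>v v)) $ i = c * (A *\<^sub>v v) $ i"
  using assms by (simp add: mult_mat_vec[OF assms(1,2)])

text \<open>One index \<open>t = i * 2 ^ n + j\<close> stands for both halves of an inner register,
  so that each register contributes a single summation variable.\<close>

definition pauli_block :: "nat \<Rightarrow> nat \<Rightarrow> complex mat" where
  "pauli_block n t = pauli_string n (t div 2 ^ n) (t mod 2 ^ n)"

lemma pauli_block_carrier [simp]: "pauli_block n t \<in> carrier_mat (2 ^ n) (2 ^ n)"
  by (simp add: pauli_block_def)

lemma pauli_string_0: "pauli_string n 0 0 = 1\<^sub>m (2 ^ n)"
proof (induction n)
  case (Suc n)
  have "pauli_string (Suc n) 0 0 = 1\<^sub>m 2 \<otimes>\<^sub>m 1\<^sub>m (2 ^ n)"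
    using pauli_carrier by (simp add: pauli_string_Suc Suc.IH)
  also have "\<dots> = 1\<^sub>m (2 ^ Suc n)"
  proof (rule eq_matI)
    fix r c :: nat assume "r < dim_row (1\<^sub>m (2 ^ Suc n) :: complex mat)" "c < dim_col (1\<^sub>m (2 ^ Suc n) :: complex mat)"
    then have rc: "r < 2 * 2 ^ n" "c < 2 * 2 ^ n" by simp_all
    moreover have "r div 2 ^ n < 2" "c div 2 ^ n < 2"
      using rc by (simp_all add: less_mult_imp_div_less)
    moreover have "r = c \<longleftrightarrow> r div 2 ^ n = c div 2 ^ n \<and> r mod 2 ^ n = c mod 2 ^ n"
      by (metis div_mult_mod_eq)
    ultimately show "(1\<^sub>m 2 \<otimes>\<^sub>m 1\<^sub>m (2 ^ n)) $$ (r, c) = (1\<^sub>m (2 ^ Suc n) :: complex mat) $$ (r, c)"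
      by (simp add: tensor_mat_def)
  qed (simp_all add: tensor_mat_def)
  finally show ?case .
qed (simp add: pauli_string_def tensor_mats_def)

lemma pauli_block_0: "pauli_block n 0 = 1\<^sub>m (2 ^ n)"
  by (simp add: pauli_block_def pauli_string_0)


section \<open>The registers of the circuit\<close>

locale circuit_registers =
  fixes n d :: nat
begin

abbreviation "m \<equiv> num_qubits n d"
abbreviation "outer x \<equiv> sub_index m (outer_qubits d) x"
text \<open>Registers are counted from 0 here, so that register \<open>r\<close> is controlled by
  outer qubit \<open>r\<close>; the gates of the circuit carry the label
  \<open>Suc r\<close>.\<close>

abbreviation "inner r x \<equiv> sub_index m (inner_qubits n d (Suc r)) x"
abbreviation "sys x \<equiv> sub_index m (system_qubits n d) x"

lemma num_qubits_eq: "m = d + 2 * n * d + n"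
  by (simp add: num_qubits_def)

lemma inner_qubits_bound: "r < d \<Longrightarrow> d + 2 * n * Suc r \<le> d + 2 * n * d"
  by (intro add_left_mono mult_le_mono2) simp

lemma set_outer_qubits: "set (outer_qubits d) = {..<d}"
  by (auto simp: outer_qubits_def)

lemma length_qubits [simp]:
  "length (outer_qubits d) = d" "length (inner_qubits n d (Suc r)) = 2 * n" "length (system_qubits n d) = n"
  by (simp_all add: outer_qubits_def inner_qubits_def system_qubits_def num_qubits_eq)

lemma distinct_qubits [simp]:
  "distinct (outer_qubits d)" "distinct (inner_qubits n d s)" "distinct (system_qubits n d)"
  by (simp_all add: outer_qubits_def inner_qubits_def system_qubits_def)

lemma qubits_subset:
  "set (outer_qubits d) \<subseteq> {..<m}" "set (system_qubits n d) \<subseteq> {..<m}"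
  "r < d \<Longrightarrow> set (inner_qubits n d (Suc r)) \<subseteq> {..<m}"
  using inner_qubits_bound[of r]
  by (auto simp: outer_qubits_def inner_qubits_def system_qubits_def num_qubits_eq)

lemma qubits_disjoint:
  "set (outer_qubits d) \<inter> set (system_qubits n d) = {}"
  "set (outer_qubits d) \<inter> set (inner_qubits n d (Suc r)) = {}"
  "r < d \<Longrightarrow> set (inner_qubits n d (Suc r)) \<inter> set (system_qubits n d) = {}"
  "r \<noteq> r' \<Longrightarrow> set (inner_qubits n d (Suc r)) \<inter> set (inner_qubits n d (Suc r')) = {}"
proof -
  show "r < d \<Longrightarrow> set (inner_qubits n d (Suc r)) \<inter> set (system_qubits n d) = {}"
    using inner_qubits_bound[of r] by (auto simp: inner_qubits_def system_qubits_def)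
  have *: "set (inner_qubits n d (Suc r)) \<inter> set (inner_qubits n d (Suc r')) = {}" if "r < r'" for r r'
  proof -
    have "2 * n * Suc r \<le> 2 * n * r'" using that by (intro mult_le_mono2) simp
    then show ?thesis by (auto simp: inner_qubits_def)
  qed
  then show "r \<noteq> r' \<Longrightarrow> set (inner_qubits n d (Suc r)) \<inter> set (inner_qubits n d (Suc r')) = {}"
    by (metis Int_commute nat_neq_iff)
qed (auto simp: outer_qubits_def inner_qubits_def system_qubits_def)

lemma outer_qbit_fibre_inner:
  assumes "y \<in> fibre m (inner_qubits n d (Suc r)) x" "q < d"
  shows "qbit m y q = qbit m x q"
  using assms qubits_subset(1) qubits_disjoint(2)[of r] unfolding set_outer_qubits
  by (intro fibre_qbit[OF assms(1)]) auto

lemma fibre_inner: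
  assumes "y \<in> fibre m (inner_qubits n d (Suc r)) x" "r < d"
  shows "outer y = outer x" "sys y = sys x" "r' < d \<Longrightarrow> r' \<noteq> r \<Longrightarrow> inner r' y = inner r' x"
  using assms(2) qubits_subset qubits_disjoint
  by (intro fibre_sub_index[OF assms(1)]; blast)+

lemma fibre_system:
  assumes "y \<in> fibre m (system_qubits n d) x"
  shows "outer y = outer x" "r < d \<Longrightarrow> inner r y = inner r x"
    "q < d \<Longrightarrow> qbit m y q = qbit m x q"
proof -
  show "outer y = outer x" "r < d \<Longrightarrow> inner r y = inner r x"
    using qubits_subset qubits_disjoint by (intro fibre_sub_index[OF assms]; blast)+
  show "q < d \<Longrightarrow> qbit m y q = qbit m x q"
    using qubits_subset(1) qubits_disjoint(1) unfolding set_outer_qubits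
    by (intro fibre_qbit[OF assms]) auto
qed

lemma fibre_outer:
  assumes "y \<in> fibre m (outer_qubits d) x"
  shows "sys y = sys x" "r < d \<Longrightarrow> inner r y = inner r x"
  using qubits_subset qubits_disjoint by (intro fibre_sub_index[OF assms]; blast)+

section \<open>Evolution of the amplitudes through the layers of gates\<close>

lemma C_gate_carrier [simp]: "C_gate n d s V \<in> carrier_mat (2 ^ m) (2 ^ m)"
  and SELECT_gate_carrier [simp]: "SELECT_gate n d s \<in> carrier_mat (2 ^ m) (2 ^ m)"
  by (simp_all add: C_gate_def SELECT_gate_def)

text \<open>The description of \<open>v\<close> by \<open>w\<close> is asked for only on branches
  with control bit 1. In \<open>unprepare_inner\<close> the register has a different form on the
  other branches, where the gate leaves \<open>v\<close> as it is.\<close>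

lemma C_gate_mult_vec:
  assumes "r < d" "V \<in> carrier_mat (2 ^ (2 * n)) (2 ^ (2 * n))"
    and "v \<in> carrier_vec (2 ^ m)" "x < 2 ^ m" "w \<in> carrier_vec (2 ^ (2 * n))"
    and "\<And>y. y \<in> fibre m (inner_qubits n d (Suc r)) x \<Longrightarrow> qbit m x r \<noteq> 0 \<Longrightarrow> v $ y = w $ inner r y"
  shows "(C_gate n d (Suc r) V *\<^sub>v v) $ x = (if qbit m x r = 0 then v $ x else (V *\<^sub>v w) $ inner r x)"
proof -
  have "r \<in> set (outer_qubits d)" using assms(1) by (simp add: set_outer_qubits)
  then have "r < m" "r \<notin> set (inner_qubits n d (Suc r))"
    using qubits_subset(1) qubits_disjoint(2)[of r] by auto
  then have "(C_gate n d (Suc r) V *\<^sub>v v) $ x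
      = (if qbit m x r = 0 then v $ x else (gate_on m (inner_qubits n d (Suc r)) V *\<^sub>v v) $ x)"
    using assms qubits_subset(3)[of r] unfolding C_gate_def by (subst gate_on_controlled) auto
  moreover have "(gate_on m (inner_qubits n d (Suc r)) V *\<^sub>v v) $ x = (V *\<^sub>v w) $ inner r x"
    if "qbit m x r \<noteq> 0"
    using assms that qubits_subset(3)[of r] by (intro gate_on_mult_vec_local) auto
  ultimately show ?thesis by simp
qed

lemma SELECT_gate_mult_vec:
  assumes "r < d" "v \<in> carrier_vec (2 ^ m)" "x < 2 ^ m" "w \<in> carrier_vec (2 ^ n)"
    and "\<And>y. y \<in> fibre m (system_qubits n d) x \<Longrightarrow> v $ y = w $ sys y"
  shows "(SELECT_gate n d (Suc r) *\<^sub>v v) $ x = (pauli_block n (inner r x) *\<^sub>v w) $ sys x"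
proof -
  have "(SELECT_gate n d (Suc r) *\<^sub>v v) $ x
      = (gate_on m (system_qubits n d) (pauli_block n (inner r x)) *\<^sub>v v) $ x"
    using assms qubits_subset(2) qubits_subset(3)[of r] qubits_disjoint(3)[of r]
    unfolding SELECT_gate_def pauli_block_def by (intro gate_on_select) auto
  also have "\<dots> = (pauli_block n (inner r x) *\<^sub>v w) $ sys x"
    using assms qubits_subset(2) by (intro gate_on_mult_vec_local) auto
  finally show ?thesis .
qed

text \<open>For every value of the outer ancillas the state stays a product over the registers, and
  each gate changes one factor of it. The induction is on the number of gates applied so
  far.\<close>

lemma prepare_inner:
  assumes V: "V \<in> carrier_mat (2 ^ (2 * n)) (2 ^ (2 * n))" and e: "e \<in> carrier_vec (2 ^ (2 * n))"
    and v: "v \<in> carrier_vec (2 ^ m)"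
    and v_eq: "\<And>x. x < 2 ^ m \<Longrightarrow> v $ x = \<rho> (outer x) * (\<Prod>r<d. e $ inner r x) * \<phi> $ sys x"
    and "l \<le> d" "x < 2 ^ m"
  shows "(mat_prod (2 ^ m) (map (\<lambda>s. C_gate n d s V) (rev [1..<l + 1])) *\<^sub>v v) $ x
    = \<rho> (outer x) * (\<Prod>r<d. (if r < l \<and> qbit m x r \<noteq> 0 then V *\<^sub>v e else e) $ inner r x) * \<phi> $ sys x"
  using \<open>l \<le> d\<close> \<open>x < 2 ^ m\<close>
proof (induction l arbitrary: x)
  case 0
  then show ?case using v v_eq by (simp add: mat_prod_Nil_mult_vec)
next
  case (Suc l)
  then have l: "l < d" by simp
  define u where "u = mat_prod (2 ^ m) (map (\<lambda>s. C_gate n d s V) (rev [1..<l + 1])) *\<^sub>v v"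
  have u: "u \<in> carrier_vec (2 ^ m)"
    unfolding u_def using v by (intro mult_mat_vec_carrier[OF mat_prod_carrier]) auto
  let ?g = "\<lambda>l r x. (if r < l \<and> qbit m x r \<noteq> 0 then V *\<^sub>v e else e) $ inner r x"
  \<comment> \<open>The amplitude of everything except register \<open>l\<close>. That register is
    still in state \<open>e\<close>, because \<open>r < l\<close> fails at \<open>r = l\<close>, so
    \<open>u\<close> is \<open>?c\<close> times \<open>e\<close> along it.\<close>
  let ?c = "\<rho> (outer x) * (\<Prod>r\<in>{..<d} - {l}. ?g l r x) * \<phi> $ sys x"
  have split: "(\<Prod>r<d. f r) = f l * (\<Prod>r\<in>{..<d} - {l}. f r)" for f :: "nat \<Rightarrow> complex"
    using l by (intro prod.remove) auto
  have "mat_prod (2 ^ m) (map (\<lambda>s. C_gate n d s V) (rev [1..<Suc l + 1])) *\<^sub>v v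
      = C_gate n d (Suc l) V *\<^sub>v u"
    unfolding u_def rev_upt_Suc list.map using v by (intro mat_prod_Cons_mult_vec) auto
  also have "\<dots> $ x = (if qbit m x l = 0 then u $ x else (V *\<^sub>v (?c \<cdot>\<^sub>v e)) $ inner l x)"
  proof (rule C_gate_mult_vec[OF l V u])
    fix y assume y: "y \<in> fibre m (inner_qubits n d (Suc l)) x"
    then have "y < 2 ^ m" by (simp add: fibre_def)
    moreover have "(\<Prod>r\<in>{..<d} - {l}. ?g l r y) = (\<Prod>r\<in>{..<d} - {l}. ?g l r x)"
      using l by (intro prod.cong) (auto simp: fibre_inner[OF y l] outer_qbit_fibre_inner[OF y])
    ultimately show "u $ y = (?c \<cdot>\<^sub>v e) $ inner l y"
      using Suc.IH[of y] l e fibre_inner[OF y l] sub_index_less[of m "inner_qubits n d (Suc l)" y]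
      unfolding u_def split by simp
  qed (use Suc.prems e in auto)
  also have "\<dots> = \<rho> (outer x) * (\<Prod>r<d. ?g (Suc l) r x) * \<phi> $ sys x"
  proof -
    have "(\<Prod>r\<in>{..<d} - {l}. ?g (Suc l) r x) = (\<Prod>r\<in>{..<d} - {l}. ?g l r x)"
      by (intro prod.cong) (auto simp: less_Suc_eq)
    then show ?thesis
      using Suc.IH[of x, folded u_def] Suc.prems l sub_index_less[of m "inner_qubits n d (Suc l)" x]
      unfolding split by (simp add: mult_smult_mult_vec_index[OF V e])
  qed
  finally show ?case .
qed

text \<open>\<open>SELECT\<close> preserves the basis value of an inner register, so for fixed
  values of all registers the system undergoes a fixed product of Pauli strings. The factor of the
  last register is outermost.\<close>

primrec select_chain :: "complex vec \<Rightarrow> nat \<Rightarrow> nat \<Rightarrow> complex vec" where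
  "select_chain \<phi> 0 x = \<phi>"
| "select_chain \<phi> (Suc r) x = pauli_block n (inner r x) *\<^sub>v select_chain \<phi> r x"

lemma select_chain_carrier: "\<phi> \<in> carrier_vec (2 ^ n) \<Longrightarrow> select_chain \<phi> r x \<in> carrier_vec (2 ^ n)"
  by (induction r) (auto intro: mult_mat_vec_carrier[OF pauli_block_carrier])

lemma select_chain_cong:
  "(\<And>r'. r' < r \<Longrightarrow> inner r' x = inner r' y) \<Longrightarrow> select_chain \<phi> r x = select_chain \<phi> r y"
  by (induction r) auto

text \<open>\<open>SELECT\<close> entangles the system with the inner registers, so no product form
  survives. What survives is a factor \<open>G\<close> depending on the ancillas alone; it is
  constant along the system fibre and passes through every Pauli string.\<close>

lemma select_all:
  assumes v: "v \<in> carrier_vec (2 ^ m)" and \<phi>: "\<phi> \<in> carrier_vec (2 ^ n)"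
    and v_eq: "\<And>x. x < 2 ^ m \<Longrightarrow> v $ x = G x * \<phi> $ sys x"
    and G: "\<And>x y. y \<in> fibre m (system_qubits n d) x \<Longrightarrow> G y = G x"
    and "l \<le> d" "x < 2 ^ m"
  shows "(mat_prod (2 ^ m) (map (\<lambda>s. SELECT_gate n d s) (rev [1..<l + 1])) *\<^sub>v v) $ x
    = G x * select_chain \<phi> l x $ sys x"
  using \<open>l \<le> d\<close> \<open>x < 2 ^ m\<close>
proof (induction l arbitrary: x)
  case 0
  then show ?case using v v_eq by (simp add: mat_prod_Nil_mult_vec)
next
  case (Suc l)
  then have l: "l < d" by simp
  define u where "u = mat_prod (2 ^ m) (map (\<lambda>s. SELECT_gate n d s) (rev [1..<l + 1])) *\<^sub>v v"
  have u: "u \<in> carrier_vec (2 ^ m)"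
    unfolding u_def using v by (intro mult_mat_vec_carrier[OF mat_prod_carrier]) auto
  note \<chi> = select_chain_carrier[OF \<phi>, of l x]
  have "mat_prod (2 ^ m) (map (\<lambda>s. SELECT_gate n d s) (rev [1..<Suc l + 1])) *\<^sub>v v
      = SELECT_gate n d (Suc l) *\<^sub>v u"
    unfolding u_def rev_upt_Suc list.map using v by (intro mat_prod_Cons_mult_vec) auto
  also have "\<dots> $ x = (pauli_block n (inner l x) *\<^sub>v (G x \<cdot>\<^sub>v select_chain \<phi> l x)) $ sys x"
  proof (rule SELECT_gate_mult_vec[OF l u])
    fix y assume y: "y \<in> fibre m (system_qubits n d) x"
    then have "y < 2 ^ m" by (simp add: fibre_def)
    moreover have "select_chain \<phi> l y = select_chain \<phi> l x"
      using l by (intro select_chain_cong fibre_system[OF y]) auto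
    ultimately show "u $ y = (G x \<cdot>\<^sub>v select_chain \<phi> l x) $ sys y"
      using Suc.IH[of y] l G[OF y] \<chi> sub_index_less[of m "system_qubits n d" y] by (simp add: u_def)
  qed (use Suc.prems \<chi> in auto)
  also have "\<dots> = G x * select_chain \<phi> (Suc l) x $ sys x"
    using sub_index_less[of m "system_qubits n d" x]
    by (simp add: mult_smult_mult_vec_index[OF pauli_block_carrier \<chi>])
  finally show ?case .
qed

end

section \<open>Contraction of the inner registers\<close>

lemma mult_mult_mult_vec_index:
  fixes A B :: "complex mat"
  assumes "A \<in> carrier_mat N N" "B \<in> carrier_mat N N" "v \<in> carrier_vec N" "z < N"
  shows "(A *\<^sub>v (B *\<^sub>v v)) $ z = (\<Sum>i<N. \<Sum>j<N. A $$ (z, i) * (B $$ (i, j) * v $ j))"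
  using assms by (auto simp: scalar_prod_def atLeast0LessThan sum_distrib_left intro!: sum.cong)

text \<open>Linearity in the middle factor. For the contraction of one register, \<open>C t\<close>
  is the Pauli block of its value, \<open>B\<close> the resulting operator \<open>K\<close>, and
  \<open>A\<close> the power of \<open>K\<close> collected from the later registers.\<close>

lemma sum_mult_mult_mult_vec:
  fixes A B :: "complex mat" and C :: "'i \<Rightarrow> complex mat"
  assumes "A \<in> carrier_mat N N" "B \<in> carrier_mat N N" "\<And>t. C t \<in> carrier_mat N N"
    and "v \<in> carrier_vec N" "z < N"
    and "\<And>i j. i < N \<Longrightarrow> j < N \<Longrightarrow> B $$ (i, j) = (\<Sum>t\<in>T. c t * C t $$ (i, j))"
  shows "(\<Sum>t\<in>T. c t * (A *\<^sub>v (C t *\<^sub>v v)) $ z) = (A *\<^sub>v (B *\<^sub>v v)) $ z"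
proof -
  have "(A *\<^sub>v (B *\<^sub>v v)) $ z
      = (\<Sum>i<N. \<Sum>j<N. \<Sum>t\<in>T. c t * (A $$ (z, i) * (C t $$ (i, j) * v $ j)))"
    unfolding mult_mult_mult_vec_index[OF assms(1,2,4,5)]
    by (intro sum.cong refl) (simp add: assms(6) sum_distrib_left sum_distrib_right ac_simps)
  also have "\<dots> = (\<Sum>t\<in>T. \<Sum>i<N. \<Sum>j<N. c t * (A $$ (z, i) * (C t $$ (i, j) * v $ j)))"
    by (subst sum.swap[of _ T]) (simp add: sum.swap[of _ T])
  also have "\<dots> = (\<Sum>t\<in>T. c t * (A *\<^sub>v (C t *\<^sub>v v)) $ z)"
    by (simp only: mult_mult_mult_vec_index[OF assms(1,3,4,5)] sum_distrib_left)
  finally show ?thesis ..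
qed

context circuit_registers
begin

text \<open>
  The gates \<open>C\<^sub>d, \<dots>, C\<^sub>1\<close> are applied in this order, so that contracting register \<open>l + 1\<close> peels the
  outermost factor off \<open>select_chain \<phi> (l + 1) x\<close>.
\<close>

lemma unprepare_inner:
  assumes V: "V \<in> carrier_mat (2 ^ (2 * n)) (2 ^ (2 * n))"
    and p: "p \<in> carrier_vec (2 ^ (2 * n))" and e: "e \<in> carrier_vec (2 ^ (2 * n))" "e $ 0 = 1"
    and K: "K \<in> carrier_mat (2 ^ n) (2 ^ n)"
    and K_eq: "\<And>i j. i < 2 ^ n \<Longrightarrow> j < 2 ^ n \<Longrightarrow>
      K $$ (i, j) = (\<Sum>t<2 ^ (2 * n). V $$ (0, t) * p $ t * pauli_block n t $$ (i, j))"
    and v: "v \<in> carrier_vec (2 ^ m)" and \<phi>: "\<phi> \<in> carrier_vec (2 ^ n)"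
    and v_eq: "\<And>x. x < 2 ^ m \<Longrightarrow> v $ x = \<rho> (outer x)
      * (\<Prod>r<d. (if qbit m x r \<noteq> 0 then p else e) $ inner r x) * select_chain \<phi> d x $ sys x"
    and "l \<le> d" "x < 2 ^ m" "\<And>r. l \<le> r \<Longrightarrow> r < d \<Longrightarrow> inner r x = 0"
  shows "(mat_prod (2 ^ m) (map (\<lambda>s. C_gate n d s V) [l + 1..<d + 1]) *\<^sub>v v) $ x
    = \<rho> (outer x) * (\<Prod>r<l. (if qbit m x r \<noteq> 0 then p else e) $ inner r x)
      * ((K ^\<^sub>m (\<Sum>r = l..<d. qbit m x r)) *\<^sub>v select_chain \<phi> l x) $ sys x"
  using \<open>l \<le> d\<close> \<open>x < 2 ^ m\<close> assms(12)
\<comment> \<open>Downward from \<open>l = d\<close>, where no gate has acted, to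
  \<open>l = 0\<close>, where all have. Only amplitudes with value 0 in the registers from
  \<open>l\<close> on are followed, since these are the ones that survive the final
  projection.\<close>
proof (induction l arbitrary: x rule: inc_induct)
  case base
  note select_chain_carrier[OF \<phi>, of d x]
  then show ?case using v v_eq[OF base(1)] K by (simp add: mat_prod_Nil_mult_vec)
next
  case (step l)
  let ?N = "2 ^ n :: nat"
  let ?g = "\<lambda>r x. (if qbit m x r \<noteq> 0 then p else e) $ inner r x"
  note l = \<open>l < d\<close>
  define u where "u = mat_prod (2 ^ m) (map (\<lambda>s. C_gate n d s V) [Suc l + 1..<d + 1]) *\<^sub>v v"
  have u: "u \<in> carrier_vec (2 ^ m)"
    unfolding u_def using v by (intro mult_mat_vec_carrier[OF mat_prod_carrier]) auto
  note IH = step.IH[folded u_def]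
  define E where "E = K ^\<^sub>m (\<Sum>r = Suc l..<d. qbit m x r)"
  define c where "c = \<rho> (outer x) * (\<Prod>r<l. ?g r x)"
  define \<chi> where "\<chi> = select_chain \<phi> l x"
  have E: "E \<in> carrier_mat ?N ?N" using K by (simp add: E_def pow_carrier_mat)
  have \<chi>: "\<chi> \<in> carrier_vec ?N" using \<phi> by (simp add: \<chi>_def select_chain_carrier)
  \<comment> \<open>The amplitude as a function of the value \<open>t\<close> of register
    \<open>l\<close> when its control bit is 1: \<open>p $ t\<close> from the preparation, and the
    system vector hit first by the Pauli block of \<open>t\<close> and then by the power
    \<open>E\<close> from the later registers.\<close>
  define w where "w = vec (2 ^ (2 * n)) (\<lambda>t. c * p $ t * (E *\<^sub>v (pauli_block n t *\<^sub>v \<chi>)) $ sys x)"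
  have sys: "sys x < ?N" using sub_index_less[of m "system_qubits n d" x] by simp
  have "[l + 1..<d + 1] = Suc l # [Suc l + 1..<d + 1]"
    using l by (simp add: upt_conv_Cons)
  then have "mat_prod (2 ^ m) (map (\<lambda>s. C_gate n d s V) [l + 1..<d + 1]) *\<^sub>v v = C_gate n d (Suc l) V *\<^sub>v u"
    unfolding u_def using v by (simp only: list.map) (intro mat_prod_Cons_mult_vec; auto)
  also have "\<dots> $ x = (if qbit m x l = 0 then u $ x else (V *\<^sub>v w) $ inner l x)"
  proof (rule C_gate_mult_vec[OF l V u])
    fix y assume y: "y \<in> fibre m (inner_qubits n d (Suc l)) x" and q: "qbit m x l \<noteq> 0"
    have y': "y < 2 ^ m" using y by (simp add: fibre_def)
    have "(\<Prod>r<l. ?g r y) = (\<Prod>r<l. ?g r x)"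
      using l by (intro prod.cong) (auto simp: fibre_inner[OF y l] outer_qbit_fibre_inner[OF y])
    moreover have "(\<Sum>r = Suc l..<d. qbit m y r) = (\<Sum>r = Suc l..<d. qbit m x r)"
      by (intro sum.cong) (auto simp: outer_qbit_fibre_inner[OF y])
    moreover have "select_chain \<phi> l y = \<chi>"
      unfolding \<chi>_def using l by (intro select_chain_cong fibre_inner[OF y l]) auto
    moreover have "inner r y = 0" if "Suc l \<le> r" "r < d" for r
      using that step.prems(2) fibre_inner(3)[OF y l] by simp
    moreover have "qbit m y l \<noteq> 0" using q outer_qbit_fibre_inner[OF y l] by simp
    ultimately show "u $ y = w $ inner l y"
      using IH[OF y'] sub_index_less[of m "inner_qubits n d (Suc l)" y]
      by (simp add: w_def c_def E_def fibre_inner[OF y l])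
  qed (use step.prems in \<open>auto simp: w_def\<close>)
  also have "\<dots> = c * ((K ^\<^sub>m (\<Sum>r = l..<d. qbit m x r)) *\<^sub>v \<chi>) $ sys x"
  proof (cases "qbit m x l = 0")
    case True
    \<comment> \<open>With control bit 0 the register holds \<open>e\<close> and has value 0. Its
      amplitude is then \<open>e $ 0 = 1\<close> and its Pauli block the identity, so it contributes
      no factor.\<close>
    have "u $ x = c * (E *\<^sub>v \<chi>) $ sys x"
      using IH[of x] step.prems l True e \<chi> by (simp add: c_def E_def \<chi>_def pauli_block_0)
    moreover have "(\<Sum>r = l..<d. qbit m x r) = (\<Sum>r = Suc l..<d. qbit m x r)"
      using l True by (simp add: sum.atLeast_Suc_lessThan)
    ultimately show ?thesis using True by (simp add: E_def)
  next
    case False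
    then have "qbit m x l = 1" by (simp only: qbit_eq_1_iff not_False_eq_True)
    then have "(\<Sum>r = l..<d. qbit m x r) = Suc (\<Sum>r = Suc l..<d. qbit m x r)"
      using l by (simp add: sum.atLeast_Suc_lessThan)
    \<comment> \<open>The power of a matrix grows on the right, exactly where the block of register
      \<open>l\<close> stands, so the new factor \<open>K\<close> needs no commutation.\<close>
    then have "(K ^\<^sub>m (\<Sum>r = l..<d. qbit m x r)) *\<^sub>v \<chi> = E *\<^sub>v (K *\<^sub>v \<chi>)"
      using assoc_mult_mat_vec[OF E K \<chi>] by (simp add: E_def)
    moreover have "(V *\<^sub>v w) $ 0 = c * (\<Sum>t<2 ^ (2 * n). V $$ (0, t) * p $ t * (E *\<^sub>v (pauli_block n t *\<^sub>v \<chi>)) $ sys x)"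
      using V by (auto simp: w_def scalar_prod_def atLeast0LessThan sum_distrib_left intro!: sum.cong)
    moreover have "(\<Sum>t<2 ^ (2 * n). V $$ (0, t) * p $ t * (E *\<^sub>v (pauli_block n t *\<^sub>v \<chi>)) $ sys x)
        = (E *\<^sub>v (K *\<^sub>v \<chi>)) $ sys x"
      by (rule sum_mult_mult_mult_vec[OF E K _ \<chi> sys K_eq]) simp_all
    ultimately show ?thesis using False step.prems(2) l by simp
  qed
  finally show ?case by (simp add: c_def \<chi>_def)
qed

end

section \<open>Adjoints, projection of the ancillas and the amplitudes of the whole circuit\<close>

lemma index_mat_adjoint [simp]:
  fixes A :: "complex mat"
  assumes "i < dim_col A" "j < dim_row A"
  shows "mat_adjoint A $$ (i, j) = cnj (A $$ (j, i))"
  using assms by (simp add: mat_adjoint_def mat_of_rows_def conjugate_vec_def cols_def)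

lemma mat_adjoint_carrier [simp]: "A \<in> carrier_mat N M \<Longrightarrow> mat_adjoint A \<in> carrier_mat M N"
  by (auto simp: mat_adjoint_def)

lemma bra0_carrier [simp]: "bra0 a \<in> carrier_mat 1 (2 ^ a)"
  unfolding bra0_def by (rule mat_adjoint_carrier) (simp add: mat_of_cols_def)

lemma bra0_index: "c < 2 ^ a \<Longrightarrow> bra0 a $$ (0, c) = (if c = 0 then 1 else 0)"
  by (simp add: bra0_def mat_of_cols_def ket_def)

lemma bra0_tensor:
  assumes "B \<in> carrier_mat p q"
  shows "bra0 a \<otimes>\<^sub>m B = mat p (2 ^ a * q) (\<lambda>(r, c). if c < q then B $$ (r, c) else 0)"
proof -
  have "c div q < 2 ^ a" if "c < 2 ^ a * q" for c :: nat
    using that by (simp add: less_mult_imp_div_less)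
  moreover have "c div q = 0 \<longleftrightarrow> c < q" if "c < 2 ^ a * q" for c :: nat
    using that by (cases "q = 0") (auto simp: div_eq_0_iff)
  ultimately show ?thesis
    using assms carrier_matD[OF bra0_carrier[of a]]
    by (intro eq_matI) (auto simp: tensor_mat_def bra0_index)
qed

lemma ket_carrier [simp]: "ket a x \<in> carrier_vec (2 ^ a)"
  by (simp add: ket_def)

lemma ket_index: "t < 2 ^ a \<Longrightarrow> x < 2 ^ a \<Longrightarrow> ket a x $ t = (if t = x then 1 else 0)"
  by (auto simp: ket_def)

lemma mult_ket_0_index:
  assumes "A \<in> carrier_mat N (2 ^ a)" "t < N"
  shows "(A *\<^sub>v ket a 0) $ t = A $$ (t, 0)"
  using assms by (simp add: ket_def)

context circuit_registers
begin

lemma two_pow_num_qubits: "(2::nat) ^ m = 2 ^ d * 2 ^ (2 * d * n) * 2 ^ n"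
  by (simp add: num_qubits_eq power_add ac_simps)

lemma sys_eq_mod: "sys x = x mod 2 ^ n"
  using sub_index_upt[of "d + 2 * n * d" n m x] by (simp add: system_qubits_def num_qubits_eq)

text \<open>The system register holds the \<open>n\<close> low digits of \<open>x\<close>, so
  \<open>x < 2 ^ n\<close> says that all earlier bits vanish. The inner registers tile the stretch
  between the outer ancillas and the system.\<close>

lemma ancillas_0_iff:
  assumes "x < 2 ^ m"
  shows "x < 2 ^ n \<longleftrightarrow> outer x = 0 \<and> (\<forall>r<d. inner r x = 0)"
proof -
  have set: "{d..<d + 2 * n * k} = (\<Union>r<k. set (inner_qubits n d (Suc r)))" for k
  proof (induction k)
    case (Suc k)
    have "{d..<d + 2 * n * Suc k} = {d..<d + 2 * n * k} \<union> {d + 2 * n * k..<d + 2 * n * Suc k}"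
      by (intro ivl_disj_un(17)[symmetric]) auto
    then show ?case by (simp add: Suc.IH lessThan_Suc Un_commute inner_qubits_def)
  qed simp
  have "x < 2 ^ n \<longleftrightarrow> x div 2 ^ n = 0" by (simp add: div_eq_0_iff)
  also have "x div 2 ^ n = sub_index m [0..<d + 2 * n * d] x"
    using sub_index_upt[of 0 "d + 2 * n * d" m x] assms
    by (simp add: num_qubits_eq power_add less_mult_imp_div_less)
  also have "\<dots> = 0 \<longleftrightarrow> (\<forall>q \<in> {..<d} \<union> {d..<d + 2 * n * d}. qbit m x q = 0)"
    unfolding sub_index_eq_0_iff by (intro ball_cong) auto
  also have "\<dots> \<longleftrightarrow> outer x = 0 \<and> (\<forall>r<d. inner r x = 0)"
    unfolding set sub_index_eq_0_iff set_outer_qubits by blast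
  finally show ?thesis .
qed

lemma project_ancillas:
  assumes "v \<in> carrier_vec (2 ^ m)"
  shows "(bra0 d \<otimes>\<^sub>m bra0 (2 * d * n) \<otimes>\<^sub>m 1\<^sub>m (2 ^ n)) *\<^sub>v v = vec (2 ^ n) (\<lambda>z. v $ z)"
proof (rule eq_vecI)
  let ?B = "bra0 d \<otimes>\<^sub>m bra0 (2 * d * n) \<otimes>\<^sub>m 1\<^sub>m (2 ^ n)"
  have B: "?B = mat (2 ^ n) (2 ^ m) (\<lambda>(z, x). if z = x then 1 else 0)"
  proof -
    have "bra0 (2 * d * n) \<otimes>\<^sub>m 1\<^sub>m (2 ^ n)
        = mat (2 ^ n) (2 ^ (2 * d * n) * 2 ^ n) (\<lambda>(z, x). if z = x then 1 else 0)"
      by (subst bra0_tensor[of _ "2 ^ n" "2 ^ n"]) (auto intro!: eq_matI)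
    moreover have "x < 2 ^ n \<Longrightarrow> x < 2 ^ (2 * d * n) * 2 ^ n" for x :: nat
      by (erule less_le_trans) simp
    ultimately show ?thesis
      by (subst bra0_tensor[of _ "2 ^ n" "2 ^ (2 * d * n) * 2 ^ n"])
        (auto intro!: eq_matI simp: two_pow_num_qubits mult.assoc)
  qed
  have le: "(2::nat) ^ n \<le> 2 ^ m" by (simp add: num_qubits_eq)
  show "dim_vec (?B *\<^sub>v v) = dim_vec (vec (2 ^ n) (\<lambda>z. v $ z))" by (simp add: B)
  fix z assume "z < dim_vec (vec (2 ^ n) (\<lambda>z. v $ z))"
  then have z: "z < 2 ^ n" by simp
  then have "(?B *\<^sub>v v) $ z = (\<Sum>x<2 ^ m. (if z = x then 1 else 0) * v $ x)"
    using assms le unfolding B by (simp add: scalar_prod_def atLeast0LessThan)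
  also have "\<dots> = (\<Sum>x<2 ^ m. if z = x then v $ x else 0)"
    by (intro sum.cong) auto
  finally show "(?B *\<^sub>v v) $ z = vec (2 ^ n) (\<lambda>z. v $ z) $ z" using z le by simp
qed

text \<open>The ket of all \<open>2 * d * n\<close> inner qubits is split into one factor per
  register, the form that the register-wise lemmas propagate.\<close>

lemma initial_state:
  assumes "\<phi> \<in> carrier_vec (2 ^ n)"
  shows "ket d 0 \<otimes>\<^sub>v ket (2 * d * n) 0 \<otimes>\<^sub>v \<phi> \<in> carrier_vec (2 ^ m)"
    and "x < 2 ^ m \<Longrightarrow> (ket d 0 \<otimes>\<^sub>v ket (2 * d * n) 0 \<otimes>\<^sub>v \<phi>) $ x
      = ket d 0 $ outer x * (\<Prod>r<d. ket (2 * n) 0 $ inner r x) * \<phi> $ sys x"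
proof -
  have "ket d 0 \<otimes>\<^sub>v ket (2 * d * n) 0 = ket (d + 2 * d * n) 0"
    using tensor_ket_ket[of 0 d 0 "2 * d * n"] by simp
  then have v: "ket d 0 \<otimes>\<^sub>v ket (2 * d * n) 0 \<otimes>\<^sub>v \<phi> = ket (d + 2 * d * n) 0 \<otimes>\<^sub>v \<phi>"
    by (simp flip: tensor_vec_assoc)
  have dim: "(2::nat) ^ m = 2 ^ (d + 2 * d * n) * 2 ^ n"
    by (simp add: two_pow_num_qubits power_add)
  show "ket d 0 \<otimes>\<^sub>v ket (2 * d * n) 0 \<otimes>\<^sub>v \<phi> \<in> carrier_vec (2 ^ m)"
    using assms by (intro carrier_vecI) (simp add: v dim tensor_vec_def ket_def power_add)
  assume x: "x < 2 ^ m"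
  then have "x div 2 ^ n < 2 ^ (d + 2 * d * n)"
    unfolding dim by (simp add: less_mult_imp_div_less)
  then have "(ket d 0 \<otimes>\<^sub>v ket (2 * d * n) 0 \<otimes>\<^sub>v \<phi>) $ x = (if x < 2 ^ n then \<phi> $ sys x else 0)"
    unfolding v using x assms by (simp add: tensor_vec_def sys_eq_mod ket_index dim carrier_vecD[OF ket_carrier])
      (simp add: div_eq_0_iff)
  also have "\<dots> = ket d 0 $ outer x * (\<Prod>r<d. ket (2 * n) 0 $ inner r x) * \<phi> $ sys x"
  proof -
    have "outer x < 2 ^ d" "inner r x < 2 ^ (2 * n)" for r
      using sub_index_less[of m "outer_qubits d" x] sub_index_less[of m "inner_qubits n d (Suc r)" x]
      by simp_all
    then show ?thesis unfolding ancillas_0_iff[OF x] by (auto simp: ket_index)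
  qed
  finally show "(ket d 0 \<otimes>\<^sub>v ket (2 * d * n) 0 \<otimes>\<^sub>v \<phi>) $ x
      = ket d 0 $ outer x * (\<Prod>r<d. ket (2 * n) 0 $ inner r x) * \<phi> $ sys x" .
qed

text \<open>The preparations enter through their first columns: the inner ones make up
  \<open>K\<close>, the outer ones weight the branches. The branch \<open>t\<close> is still an
  arbitrary bit string, and the exponent of \<open>K\<close> counts its ones; the unary encoding is
  used only afterwards.\<close>

lemma circuit_amplitude:
  assumes PR: "P\<^sub>R \<in> carrier_mat (2 ^ (2 * n)) (2 ^ (2 * n))"
    and PL: "P\<^sub>L \<in> carrier_mat (2 ^ (2 * n)) (2 ^ (2 * n))"
    and QR: "POLY\<^sub>R \<in> carrier_mat (2 ^ d) (2 ^ d)" and QL: "POLY\<^sub>L \<in> carrier_mat (2 ^ d) (2 ^ d)"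
    and K: "K \<in> carrier_mat (2 ^ n) (2 ^ n)"
    and K_eq: "\<And>i j. i < 2 ^ n \<Longrightarrow> j < 2 ^ n \<Longrightarrow> K $$ (i, j) = (\<Sum>t<2 ^ (2 * n).
      cnj ((P\<^sub>L *\<^sub>v ket (2 * n) 0) $ t) * (P\<^sub>R *\<^sub>v ket (2 * n) 0) $ t * pauli_block n t $$ (i, j))"
    and \<phi>: "\<phi> \<in> carrier_vec (2 ^ n)" and z: "z < 2 ^ n"
  shows "(circuit n d P\<^sub>R P\<^sub>L POLY\<^sub>R POLY\<^sub>L *\<^sub>v (ket d 0 \<otimes>\<^sub>v ket (2 * d * n) 0 \<otimes>\<^sub>v \<phi>)) $ z
    = (\<Sum>t<2 ^ d. cnj ((POLY\<^sub>L *\<^sub>v ket d 0) $ t) * (POLY\<^sub>R *\<^sub>v ket d 0) $ t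
        * ((K ^\<^sub>m (\<Sum>q<d. qbit d t q)) *\<^sub>v \<phi>) $ z)"
proof -
  let ?M = "2 ^ m :: nat"
  let ?e = "ket (2 * n) 0" and ?\<rho> = "\<lambda>t. (POLY\<^sub>R *\<^sub>v ket d 0) $ t"
  let ?g = "\<lambda>r x. (if qbit m x r \<noteq> 0 then P\<^sub>R *\<^sub>v ?e else ?e) $ inner r x"
  define v0 where "v0 = ket d 0 \<otimes>\<^sub>v ket (2 * d * n) 0 \<otimes>\<^sub>v \<phi>"
  define U1 where "U1 = gate_on m (outer_qubits d) POLY\<^sub>R"
  define U2 where "U2 = mat_prod ?M (map (\<lambda>s. C_gate n d s P\<^sub>R) (rev [1..<d + 1]))"
  define U3 where "U3 = mat_prod ?M (map (\<lambda>s. SELECT_gate n d s) (rev [1..<d + 1]))"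
  define U4 where "U4 = mat_prod ?M (map (\<lambda>s. C_gate n d s (mat_adjoint P\<^sub>L)) [1..<d + 1])"
  define U5 where "U5 = gate_on m (outer_qubits d) (mat_adjoint POLY\<^sub>L)"
  have U: "U1 \<in> carrier_mat ?M ?M" "U2 \<in> carrier_mat ?M ?M" "U3 \<in> carrier_mat ?M ?M"
    "U4 \<in> carrier_mat ?M ?M" "U5 \<in> carrier_mat ?M ?M"
    unfolding U1_def U2_def U3_def U4_def U5_def by (rule gate_on_carrier mat_prod_carrier; auto)+
  have v0: "v0 \<in> carrier_vec ?M" using initial_state(1)[OF \<phi>] by (simp add: v0_def)
  define v1 where "v1 = U1 *\<^sub>v v0"
  define v2 where "v2 = U2 *\<^sub>v v1"
  define v3 where "v3 = U3 *\<^sub>v v2"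
  define v4 where "v4 = U4 *\<^sub>v v3"
  have v1: "v1 \<in> carrier_vec ?M" unfolding v1_def by (rule mult_mat_vec_carrier[OF U(1) v0])
  have v2: "v2 \<in> carrier_vec ?M" unfolding v2_def by (rule mult_mat_vec_carrier[OF U(2) v1])
  have v3: "v3 \<in> carrier_vec ?M" unfolding v3_def by (rule mult_mat_vec_carrier[OF U(3) v2])
  have v4: "v4 \<in> carrier_vec ?M" unfolding v4_def by (rule mult_mat_vec_carrier[OF U(4) v3])
  have circ: "circuit n d P\<^sub>R P\<^sub>L POLY\<^sub>R POLY\<^sub>L *\<^sub>v v0 = U5 *\<^sub>v v4"
  proof -
    have "circuit n d P\<^sub>R P\<^sub>L POLY\<^sub>R POLY\<^sub>L = U5 * U4 * U3 * U2 * U1"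
      by (simp only: circuit_def Let_def U1_def U2_def U3_def U4_def U5_def)
    moreover have "U5 * U4 \<in> carrier_mat ?M ?M" "U5 * U4 * U3 \<in> carrier_mat ?M ?M"
      "U5 * U4 * U3 * U2 \<in> carrier_mat ?M ?M"
      using U by (auto intro: mult_carrier_mat)
    ultimately show ?thesis
      using U v0 v1 v2 v3 by (simp add: assoc_mult_mat_vec[of _ ?M ?M _ ?M] v1_def v2_def v3_def v4_def)
  qed
  have v1_eq: "v1 $ x = ?\<rho> (outer x) * (\<Prod>r<d. ?e $ inner r x) * \<phi> $ sys x" if x: "x < ?M" for x
  proof -
    let ?c = "(\<Prod>r<d. ?e $ inner r x) * \<phi> $ sys x"
    have "v1 $ x = (POLY\<^sub>R *\<^sub>v (?c \<cdot>\<^sub>v ket d 0)) $ outer x"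
      unfolding v1_def U1_def
    proof (rule gate_on_mult_vec_local)
      fix y assume y: "y \<in> fibre m (outer_qubits d) x"
      then have "y < ?M" by (simp add: fibre_def)
      then show "v0 $ y = (?c \<cdot>\<^sub>v ket d 0) $ outer y"
        using sub_index_less[of m "outer_qubits d" y]
        by (simp add: v0_def initial_state(2)[OF \<phi>] fibre_outer[OF y] carrier_vecD[OF ket_carrier])
    qed (use x v0 QR qubits_subset(1) in auto)
    then show ?thesis
      using sub_index_less[of m "outer_qubits d" x] by (simp add: mult_smult_mult_vec_index[OF QR])
  qed
  have v2_eq: "v2 $ x = ?\<rho> (outer x) * (\<Prod>r<d. ?g r x) * \<phi> $ sys x" if x: "x < ?M" for x
    using prepare_inner[OF PR ket_carrier v1 v1_eq order_refl x] by (simp add: v2_def U2_def)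
  have v3_eq: "v3 $ x = ?\<rho> (outer x) * (\<Prod>r<d. ?g r x) * select_chain \<phi> d x $ sys x" if x: "x < ?M" for x
  proof -
    have "?\<rho> (outer y) * (\<Prod>r<d. ?g r y) = ?\<rho> (outer x) * (\<Prod>r<d. ?g r x)"
      if y: "y \<in> fibre m (system_qubits n d) x" for x y
      using fibre_system[OF y] by simp
    from select_all[OF v2 \<phi> v2_eq this order_refl x] show ?thesis by (simp add: v3_def U3_def)
  qed
  have v4_eq: "v4 $ x = ?\<rho> (outer x) * ((K ^\<^sub>m (\<Sum>r<d. qbit m x r)) *\<^sub>v \<phi>) $ sys x"
    if x: "x < ?M" "\<And>r. r < d \<Longrightarrow> inner r x = 0" for x
  proof -
    \<comment> \<open>Row 0 of the adjoint of \<open>P\<^sub>L\<close> is the conjugate of the state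
      that \<open>P\<^sub>L\<close> prepares. This brings \<open>K_eq\<close> into the form for
      uncomputing with that adjoint.\<close>
    have "K $$ (i, j) = (\<Sum>t<2 ^ (2 * n). mat_adjoint P\<^sub>L $$ (0, t) * (P\<^sub>R *\<^sub>v ?e) $ t * pauli_block n t $$ (i, j))"
      if "i < 2 ^ n" "j < 2 ^ n" for i j
      unfolding K_eq[OF that]
    proof (intro sum.cong refl)
      fix t :: nat assume "t \<in> {..<2 ^ (2 * n)}"
      then have "mat_adjoint P\<^sub>L $$ (0, t) = cnj ((P\<^sub>L *\<^sub>v ?e) $ t)"
        using PL by (subst mult_ket_0_index[OF PL]) auto
      then show "cnj ((P\<^sub>L *\<^sub>v ?e) $ t) * (P\<^sub>R *\<^sub>v ?e) $ t * pauli_block n t $$ (i, j)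
          = mat_adjoint P\<^sub>L $$ (0, t) * (P\<^sub>R *\<^sub>v ?e) $ t * pauli_block n t $$ (i, j)"
        by (simp only:)
    qed
    \<comment> \<open>At \<open>l = 0\<close> the product over the registers is empty and the chain
      is \<open>\<phi>\<close> itself, so only the power of \<open>K\<close> remains.\<close>
    from unprepare_inner[OF mat_adjoint_carrier[OF PL] mult_mat_vec_carrier[OF PR ket_carrier] ket_carrier _ K this
        v3 \<phi> v3_eq _ x(1), of 0] x(2)
    show ?thesis by (simp add: v4_def U4_def ket_index atLeast0LessThan)
  qed
  have z': "z < ?M" by (rule less_le_trans[OF z]) (simp add: num_qubits_eq)
  have z0: "outer z = 0" "\<And>r. r < d \<Longrightarrow> inner r z = 0" "sys z = z"
    using ancillas_0_iff[OF z'] z by (auto simp: sys_eq_mod)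
  \<comment> \<open>As \<open>outer z = 0\<close>, the last gate contributes row 0 of its matrix,
    which is the projection on the state prepared by \<open>POLY\<^sub>L\<close>. The fibre runs
    over all branches, with inner registers at 0 and system value \<open>z\<close>.\<close>
  have "(U5 *\<^sub>v v4) $ z = (\<Sum>y \<in> fibre m (outer_qubits d) z. mat_adjoint POLY\<^sub>L $$ (0, outer y) * v4 $ y)"
    unfolding U5_def gate_on_mult_vec[OF v4 z'] z0 ..
  also have "\<dots> = (\<Sum>y \<in> fibre m (outer_qubits d) z. cnj ((POLY\<^sub>L *\<^sub>v ket d 0) $ outer y) * ?\<rho> (outer y)
      * ((K ^\<^sub>m (\<Sum>q<d. qbit d (outer y) q)) *\<^sub>v \<phi>) $ z)"
  proof (rule sum.cong)
    fix y assume y: "y \<in> fibre m (outer_qubits d) z"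
    then have y': "y < ?M" by (simp add: fibre_def)
    have "qbit d (outer y) q = qbit m y q" if "q < d" for q
      using that qbit_sub_index[of q "outer_qubits d" m y] by (simp add: outer_qubits_def)
    moreover have "v4 $ y = ?\<rho> (outer y) * ((K ^\<^sub>m (\<Sum>r<d. qbit m y r)) *\<^sub>v \<phi>) $ z"
      using v4_eq[OF y'] fibre_outer[OF y] z0 by simp
    moreover have "mat_adjoint POLY\<^sub>L $$ (0, outer y) = cnj ((POLY\<^sub>L *\<^sub>v ket d 0) $ outer y)"
      using sub_index_less[of m "outer_qubits d" y] QL by (subst mult_ket_0_index[OF QL]) auto
    ultimately show "mat_adjoint POLY\<^sub>L $$ (0, outer y) * v4 $ y = cnj ((POLY\<^sub>L *\<^sub>v ket d 0) $ outer y)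
        * ?\<rho> (outer y) * ((K ^\<^sub>m (\<Sum>q<d. qbit d (outer y) q)) *\<^sub>v \<phi>) $ z"
      by simp
  qed simp
  also have "\<dots> = (\<Sum>t<2 ^ d. cnj ((POLY\<^sub>L *\<^sub>v ket d 0) $ t) * ?\<rho> t
      * ((K ^\<^sub>m (\<Sum>q<d. qbit d t q)) *\<^sub>v \<phi>) $ z)"
    using sum_fibre[of "outer_qubits d" m] qubits_subset(1) by simp
  finally show ?thesis unfolding circ[unfolded v0_def] .
qed

end


section \<open>Amplitudes of the state preparations\<close>

lemma sum_div_mod:
  fixes f :: "nat \<Rightarrow> nat \<Rightarrow> 'a::comm_monoid_add"
  shows "(\<Sum>t<M * N. f (t div N) (t mod N)) = (\<Sum>(i, j) \<in> {..<M} \<times> {..<N}. f i j)"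
proof (cases "N = 0")
  case False
  then show ?thesis
    by (intro sum.reindex_bij_witness[of _ "\<lambda>(i, j). i * N + j" "\<lambda>t. (t div N, t mod N)"])
      (auto simp: less_mult_imp_div_less block_index_less)
qed simp

lemma finsum_ket_pairs_index:
  assumes t: "t < 2 ^ (2 * n)"
  shows "finsum_vec TYPE(complex) (2 ^ (2 * n)) (\<lambda>(i, j). c i j \<cdot>\<^sub>v (ket n i \<otimes>\<^sub>v ket n j))
      ({..<2 ^ n} \<times> {..<2 ^ n}) $ t = c (t div 2 ^ n) (t mod 2 ^ n)"
proof -
  have t': "t < 2 ^ n * 2 ^ n" using t by (simp add: mult_2 power_add)
  have k: "ket n i \<otimes>\<^sub>v ket n j = ket (2 * n) (i * 2 ^ n + j)" if "i < 2 ^ n" "j < 2 ^ n" for i j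
    using tensor_ket_ket[OF that] by (simp add: mult_2)
  have less: "i * 2 ^ n + j < 2 ^ (2 * n)" if "i < 2 ^ n" "j < 2 ^ n" for i j :: nat
    using block_index_less[OF that] by (simp add: mult_2 power_add)
  have "finsum_vec TYPE(complex) (2 ^ (2 * n)) (\<lambda>(i, j). c i j \<cdot>\<^sub>v (ket n i \<otimes>\<^sub>v ket n j))
      ({..<2 ^ n} \<times> {..<2 ^ n}) $ t
    = (\<Sum>ij \<in> {..<2 ^ n} \<times> {..<2 ^ n}. (case ij of (i, j) \<Rightarrow> c i j \<cdot>\<^sub>v (ket n i \<otimes>\<^sub>v ket n j)) $ t)"
    using t by (intro index_finsum_vec) (auto simp: k)
  also have "\<dots> = (\<Sum>ij \<in> {..<2 ^ n} \<times> {..<2 ^ n}.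
      if ij = (t div 2 ^ n, t mod 2 ^ n) then c (t div 2 ^ n) (t mod 2 ^ n) else 0)"
  proof (intro sum.cong refl)
    fix ij :: "nat \<times> nat" assume "ij \<in> {..<2 ^ n} \<times> {..<2 ^ n}"
    then obtain i j where ij: "ij = (i, j)" "i < 2 ^ n" "j < 2 ^ n" by auto
    then show "(case ij of (i, j) \<Rightarrow> c i j \<cdot>\<^sub>v (ket n i \<otimes>\<^sub>v ket n j)) $ t
        = (if ij = (t div 2 ^ n, t mod 2 ^ n) then c (t div 2 ^ n) (t mod 2 ^ n) else 0)"
      using t less[of i j] div_mod_eq_iff[of j "2 ^ n" t i]
      by (auto simp: k ket_index carrier_vecD[OF ket_carrier])
  qed
  also have "\<dots> = c (t div 2 ^ n) (t mod 2 ^ n)"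
    using t' by (simp add: less_mult_imp_div_less)
  finally show ?thesis .
qed

lemma pow_smult_mat:
  fixes A :: "complex mat"
  assumes A: "A \<in> carrier_mat N N"
  shows "(c \<cdot>\<^sub>m A) ^\<^sub>m k = c ^ k \<cdot>\<^sub>m (A ^\<^sub>m k)"
proof (induction k)
  case (Suc k)
  have Ak: "A ^\<^sub>m k \<in> carrier_mat N N" using A by simp
  have "(c \<cdot>\<^sub>m A) ^\<^sub>m Suc k = c ^ k \<cdot>\<^sub>m (A ^\<^sub>m k) * (c \<cdot>\<^sub>m A)" by (simp add: Suc.IH)
  also have "\<dots> = c ^ k \<cdot>\<^sub>m (c \<cdot>\<^sub>m (A ^\<^sub>m k * A))"
    using A Ak by (simp add: mult_smult_assoc_mat[OF Ak smult_carrier_mat[OF A]] mult_smult_distrib[OF Ak A])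
  also have "\<dots> = c ^ Suc k \<cdot>\<^sub>m (A ^\<^sub>m Suc k)"
    using A by (intro eq_matI) auto
  finally show ?case .
qed (use A in auto)

lemma pauli_sum_index:
  assumes "i < 2 ^ n" "j < 2 ^ n"
  shows "pauli_sum n \<alpha> $$ (i, j)
    = (\<Sum>t<2 ^ (2 * n). \<alpha> (t div 2 ^ n) (t mod 2 ^ n) * pauli_block n t $$ (i, j))"
proof -
  have smult: "(\<alpha> k l \<cdot>\<^sub>m pauli_string n k l) $$ (i, j) = \<alpha> k l * pauli_string n k l $$ (i, j)" for k l
    using assms carrier_matD[OF pauli_string_carrier[of n k l]] by (intro index_smult_mat) simp_all
  have "(2::nat) ^ (2 * n) = 2 ^ n * 2 ^ n" by (simp add: mult_2 power_add)
  then have "(\<Sum>t<2 ^ (2 * n). \<alpha> (t div 2 ^ n) (t mod 2 ^ n) * pauli_block n t $$ (i, j))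
      = (\<Sum>(k, l) \<in> {..<2 ^ n} \<times> {..<2 ^ n}. \<alpha> k l * pauli_string n k l $$ (i, j))"
    unfolding pauli_block_def
    by (simp only: sum_div_mod[of "\<lambda>k l. \<alpha> k l * pauli_string n k l $$ (i, j)"])
  then show ?thesis
    using assms by (simp add: pauli_sum_def mat_sum_def case_prod_unfold smult)
qed

text \<open>This is where \<open>H\<close> being nonzero enters: a vanishing norm would make every
  coefficient, and with them the Pauli sum, vanish.\<close>

lemma coeff_norm_pos:
  assumes "pauli_sum n \<alpha> \<noteq> 0\<^sub>m (2 ^ n) (2 ^ n)"
  shows "coeff_norm n \<alpha> > 0"
proof (rule ccontr)
  assume "\<not> coeff_norm n \<alpha> > 0"
  moreover have nonneg: "coeff_norm n \<alpha> \<ge> 0" by (simp add: coeff_norm_def sum_nonneg)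
  ultimately have "coeff_norm n \<alpha> = 0" by simp
  then have zero: "\<alpha> i j = 0" if "i < 2 ^ n" "j < 2 ^ n" for i j
    using that by (simp add: coeff_norm_def sum_nonneg sum_nonneg_eq_0_iff)
  have "pauli_sum n \<alpha> = 0\<^sub>m (2 ^ n) (2 ^ n)"
  proof (rule eq_matI)
    fix i j :: nat assume ij: "i < dim_row (0\<^sub>m (2 ^ n) (2 ^ n) :: complex mat)"
      "j < dim_col (0\<^sub>m (2 ^ n) (2 ^ n) :: complex mat)"
    have "\<alpha> (t div 2 ^ n) (t mod 2 ^ n) = 0" if "t < 2 ^ (2 * n)" for t
      using that by (intro zero) (simp_all add: less_mult_imp_div_less mult_2 power_add)
    then show "pauli_sum n \<alpha> $$ (i, j) = 0\<^sub>m (2 ^ n) (2 ^ n) $$ (i, j)"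
      using ij by (simp add: pauli_sum_index)
  qed (simp_all add: pauli_sum_def mat_sum_def)
  with assms show False by simp
qed

text \<open>At 0 the modulus kills the phase, so the value \<open>\<theta>\<close> chosen for the
  argument of 0 drops out.\<close>

lemma cmod_cis_arg_at0: "complex_of_real (cmod z) * cis (arg_at0 \<theta> z) = z"
  using rcis_cmod_Arg[of z] by (cases "z = 0") (auto simp: arg_at0_def rcis_def)

text \<open>Each state carries the square root of the weight and the phase sits in one of them only,
  so the product restores the coefficient itself.\<close>

lemma PL_PR_state_index:
  assumes N: "coeff_norm n \<alpha> > 0" and t: "t < 2 ^ (2 * n)"
  shows "cnj (PL_state n \<alpha> $ t) * PR_state \<theta> n \<alpha> $ t
    = \<alpha> (t div 2 ^ n) (t mod 2 ^ n) / complex_of_real (coeff_norm n \<alpha>)"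
proof -
  let ?N = "coeff_norm n \<alpha>" and ?a = "\<alpha> (t div 2 ^ n) (t mod 2 ^ n)"
  have dim: "dim_vec (finsum_vec TYPE(complex) (2 ^ (2 * n)) (\<lambda>(i, j). c i j \<cdot>\<^sub>v (ket n i \<otimes>\<^sub>v ket n j))
      ({..<2 ^ n} \<times> {..<2 ^ n})) = 2 ^ (2 * n)" for c
    by (intro carrier_vecD finsum_vec_closed)
      (auto simp: tensor_vec_def ket_def mult_2 power_add intro!: carrier_vecI)
  have "PL_state n \<alpha> $ t = complex_of_real (1 / sqrt ?N) * complex_of_real (sqrt (cmod ?a))"
    unfolding PL_state_def using t finsum_ket_pairs_index[OF t, of "\<lambda>i j. complex_of_real (sqrt (cmod (\<alpha> i j)))"]
    by (subst index_smult_vec) (simp_all add: dim)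
  moreover have "PR_state \<theta> n \<alpha> $ t
      = complex_of_real (1 / sqrt ?N) * (cis (arg_at0 \<theta> ?a) * complex_of_real (sqrt (cmod ?a)))"
    unfolding PR_state_def using t
      finsum_ket_pairs_index[OF t, of "\<lambda>i j. cis (arg_at0 \<theta> (\<alpha> i j)) * complex_of_real (sqrt (cmod (\<alpha> i j)))"]
    by (subst index_smult_vec) (simp_all add: dim)
  moreover have "complex_of_real (sqrt ?N) * complex_of_real (sqrt ?N) = complex_of_real ?N"
    using N by (simp flip: of_real_mult)
  moreover have "complex_of_real (sqrt (cmod ?a)) * complex_of_real (sqrt (cmod ?a)) = complex_of_real (cmod ?a)"
    by (simp flip: of_real_mult)
  ultimately have "cnj (PL_state n \<alpha> $ t) * PR_state \<theta> n \<alpha> $ t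
      = complex_of_real (cmod ?a) * cis (arg_at0 \<theta> ?a) / complex_of_real ?N"
    by (simp add: ac_simps)
  then show ?thesis by (simp only: cmod_cis_arg_at0)
qed

text \<open>The index is characterised by its bits instead of a closed formula, since only its
  number of ones and its distinctness for different \<open>k\<close> matter later.\<close>

lemma unary_ket_eq_ket:
  "\<exists>b<2 ^ d. (\<forall>q<d. qbit d b q = (if q < k then 1 else 0)) \<and> unary_ket d k = ket d b"
proof -
  have "\<exists>b<2 ^ d. \<forall>q<d. qbit d b q = (if q < k then 1 else 0)"
    by (rule ex_qbits) simp
  then obtain b where b: "b < 2 ^ d" "\<forall>q<d. qbit d b q = (if q < k then 1 else 0)" by blast
  have "unary_ket d k = tensor_vecs (map (\<lambda>q. ket 1 (qbit d b q)) [0..<d])"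
    unfolding unary_ket_def using b by (intro arg_cong[where f = tensor_vecs]) auto
  then show ?thesis using b ket_eq_tensor_bits[OF b(1)] by auto
qed

text \<open>Both superpositions are supported on the unary strings, so the sum over all
  \<open>t\<close> collapses to these. The quantity \<open>F\<close> sees only the number of ones,
  which is \<open>k\<close> on the string of \<open>k\<close>.\<close>

lemma sum_unary_superpositions:
  fixes F :: "nat \<Rightarrow> complex" and d :: nat
  defines "S \<equiv> \<lambda>c. finsum_vec TYPE(complex) (2 ^ d) (\<lambda>k. c k \<cdot>\<^sub>v unary_ket d k) {..d}"
  shows "S c \<in> carrier_vec (2 ^ d)"
    and "(\<Sum>t<2 ^ d. cnj (S c $ t) * S c' $ t * F (\<Sum>q<d. qbit d t q)) = (\<Sum>k\<le>d. cnj (c k) * c' k * F k)"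
proof -
  obtain b where b: "\<And>k. b k < 2 ^ d" "\<And>k q. q < d \<Longrightarrow> qbit d (b k) q = (if q < k then 1 else 0)"
    "\<And>k. unary_ket d k = ket d (b k)"
    using unary_ket_eq_ket[of d] by metis
  show "S c \<in> carrier_vec (2 ^ d)"
    unfolding S_def by (intro finsum_vec_closed) (auto simp: b(3))
  have weight: "(\<Sum>q<d. qbit d (b k) q) = k" if "k \<le> d" for k
  proof -
    have "(\<Sum>q<d. qbit d (b k) q) = (\<Sum>q<d. if q < k then 1 else 0)" by (simp add: b(2))
    also have "\<dots> = card ({..<d} \<inter> {q. q < k})" by (simp add: sum.If_cases)
    also have "{..<d} \<inter> {q. q < k} = {..<k}" using that by auto
    finally show ?thesis by simp
  qed
  \<comment> \<open>The number of ones recovers \<open>k\<close> only up to \<open>d\<close>; beyond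
    that the string is all ones.\<close>
  have inj: "inj_on b {..d}" by (rule inj_onI) (metis weight atMost_iff)
  have S_index: "S c $ t = (\<Sum>k\<le>d. if t = b k then c k else 0)" if "t < 2 ^ d" for c t
  proof -
    have "S c $ t = (\<Sum>k\<le>d. (c k \<cdot>\<^sub>v unary_ket d k) $ t)"
      unfolding S_def using that by (intro index_finsum_vec) (auto simp: b(3))
    also have "\<dots> = (\<Sum>k\<le>d. if t = b k then c k else 0)"
      using that by (intro sum.cong) (auto simp: b(1,3) ket_index carrier_vecD[OF ket_carrier])
    finally show ?thesis .
  qed
  have S_b: "S c $ b k = c k" if "k \<le> d" for c k
  proof -
    have "S c $ b k = (\<Sum>k'\<le>d. if k = k' then c k' else 0)"
      unfolding S_index[OF b(1)] using that inj by (intro sum.cong) (auto dest: inj_onD)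
    then show ?thesis using that by simp
  qed
  have "(\<Sum>t<2 ^ d. cnj (S c $ t) * S c' $ t * F (\<Sum>q<d. qbit d t q))
      = (\<Sum>t \<in> b ` {..d}. cnj (S c $ t) * S c' $ t * F (\<Sum>q<d. qbit d t q))"
  proof (intro sum.mono_neutral_right ballI)
    fix t assume "t \<in> {..<2 ^ d} - b ` {..d}"
    then have "S c $ t = 0" by (subst S_index) (auto intro!: sum.neutral)
    then show "cnj (S c $ t) * S c' $ t * F (\<Sum>q<d. qbit d t q) = 0" by simp
  qed (auto simp: b(1))
  also have "\<dots> = (\<Sum>k\<le>d. cnj (c k) * c' k * F k)"
    unfolding sum.reindex[OF inj] by (intro sum.cong) (auto simp: S_b weight)
  finally show "(\<Sum>t<2 ^ d. cnj (S c $ t) * S c' $ t * F (\<Sum>q<d. qbit d t q))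
      = (\<Sum>k\<le>d. cnj (c k) * c' k * F k)" .
qed

text \<open>The factor \<open>N ^ k\<close> in the squared weight cancels the normalization of the
  \<open>k\<close>-th power of \<open>K\<close>. The phases telescope even across vanishing
  coefficients, since the argument of 0 has one fixed value.\<close>

lemma poly_coefficient:
  assumes "N > 0"
  shows "cis (\<Sum>j<k. poly_phase \<theta> a j) * complex_of_real ((poly_weight a N k)\<^sup>2) * complex_of_real (1 / N) ^ k
    = cis (- arg_at0 \<theta> (a 0)) * a k"
proof -
  have "(\<Sum>j<k. poly_phase \<theta> a j) = arg_at0 \<theta> (a k) + - arg_at0 \<theta> (a 0)"
    unfolding poly_phase_def by (simp add: sum_lessThan_telescope[of "\<lambda>j. arg_at0 \<theta> (a j)"])
  moreover have "(poly_weight a N k)\<^sup>2 * (1 / N) ^ k = cmod (a k)"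
    using assms by (simp add: poly_weight_def power_one_over)
  then have "complex_of_real ((poly_weight a N k)\<^sup>2) * complex_of_real (1 / N) ^ k = complex_of_real (cmod (a k))"
    by (simp only: flip: of_real_power of_real_mult)
  ultimately have "cis (\<Sum>j<k. poly_phase \<theta> a j) * complex_of_real ((poly_weight a N k)\<^sup>2) * complex_of_real (1 / N) ^ k
      = cis (- arg_at0 \<theta> (a 0)) * (complex_of_real (cmod (a k)) * cis (arg_at0 \<theta> (a k)))"
    by (simp only: mult.assoc flip: cis_mult) (simp only: ac_simps)
  then show ?thesis by (simp only: cmod_cis_arg_at0)
qed

lemma poly_norm_pos:
  assumes "N > 0" "a d \<noteq> 0"
  shows "poly_norm d a N > 0"
  unfolding poly_norm_def
  by (rule sum_pos2[of _ d]) (use assms in \<open>auto simp: poly_weight_def\<close>)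

text \<open>Meant for \<open>X k\<close> an amplitude of the \<open>k\<close>-th power of
  \<open>H\<close> applied to a state; the powers of \<open>1 / N\<close> come from \<open>K\<close>
  being \<open>H\<close> divided by the norm.\<close>

lemma POLY_states_sum:
  fixes X :: "nat \<Rightarrow> complex"
  assumes N: "N > 0" and W: "poly_norm d a N > 0"
  shows "(\<Sum>t<2 ^ d. cnj (POLYL_state d a N $ t) * POLYR_state \<theta> d a N $ t
      * (complex_of_real (1 / N) ^ (\<Sum>q<d. qbit d t q) * X (\<Sum>q<d. qbit d t q)))
    = cis (- arg_at0 \<theta> (a 0)) / complex_of_real (poly_norm d a N) * (\<Sum>k\<le>d. a k * X k)"
proof -
  let ?W = "poly_norm d a N" and ?s = "complex_of_real (1 / sqrt (poly_norm d a N))"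
  let ?w = "\<lambda>k. complex_of_real (poly_weight a N k)" and ?p = "\<lambda>k. cis (\<Sum>j<k. poly_phase \<theta> a j)"
  let ?S = "\<lambda>c. finsum_vec TYPE(complex) (2 ^ d) (\<lambda>k. c k \<cdot>\<^sub>v unary_ket d k) {..d}"
  let ?F = "\<lambda>k. complex_of_real (1 / N) ^ k * X k"
  have s: "?s * ?s = 1 / complex_of_real ?W"
    using W by (simp flip: of_real_mult)
  have "(\<Sum>t<2 ^ d. cnj (POLYL_state d a N $ t) * POLYR_state \<theta> d a N $ t * ?F (\<Sum>q<d. qbit d t q))
      = (\<Sum>t<2 ^ d. ?s * ?s * (cnj (?S ?w $ t) * ?S (\<lambda>k. ?p k * ?w k) $ t * ?F (\<Sum>q<d. qbit d t q)))"
    unfolding POLYL_state_def POLYR_state_def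
    by (intro sum.cong) (auto simp: carrier_vecD[OF sum_unary_superpositions(1)])
  also have "\<dots> = 1 / complex_of_real ?W * (\<Sum>k\<le>d. cnj (?w k) * (?p k * ?w k) * ?F k)"
    unfolding s
    by (simp only: sum_unary_superpositions(2)[where c = ?w and c' = "\<lambda>k. ?p k * ?w k" and F = ?F]
        flip: sum_distrib_left)
  also have "(\<Sum>k\<le>d. cnj (?w k) * (?p k * ?w k) * ?F k) = (\<Sum>k\<le>d. cis (- arg_at0 \<theta> (a 0)) * (a k * X k))"
  proof (intro sum.cong refl)
    fix k
    have "cnj (?w k) * (?p k * ?w k) * ?F k
        = ?p k * complex_of_real ((poly_weight a N k)\<^sup>2) * complex_of_real (1 / N) ^ k * X k"
      by (simp add: power2_eq_square)
    also have "\<dots> = cis (- arg_at0 \<theta> (a 0)) * a k * X k"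
      by (simp only: poly_coefficient[OF N])
    finally show "cnj (?w k) * (?p k * ?w k) * ?F k = cis (- arg_at0 \<theta> (a 0)) * (a k * X k)"
      by (simp only: mult.assoc)
  qed
  finally show ?thesis by (simp flip: sum_distrib_left)
qed

lemma matrix_poly_mult_vec:
  assumes H: "H \<in> carrier_mat N N" and \<phi>: "\<phi> \<in> carrier_vec N" and z: "z < N"
  shows "(matrix_poly N d a H *\<^sub>v \<phi>) $ z = (\<Sum>k\<le>d. a k * ((H ^\<^sub>m k) *\<^sub>v \<phi>) $ z)"
proof -
  have "(matrix_poly N d a H *\<^sub>v \<phi>) $ z = (\<Sum>j<N. (\<Sum>k\<le>d. (a k \<cdot>\<^sub>m (H ^\<^sub>m k)) $$ (z, j)) * \<phi> $ j)"
    using \<phi> z by (simp add: matrix_poly_def mat_sum_def scalar_prod_def atLeast0LessThan)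
  also have "\<dots> = (\<Sum>j<N. \<Sum>k\<le>d. a k * ((H ^\<^sub>m k) $$ (z, j) * \<phi> $ j))"
    using H z by (simp add: sum_distrib_right mult.assoc)
  also have "\<dots> = (\<Sum>k\<le>d. \<Sum>j<N. a k * ((H ^\<^sub>m k) $$ (z, j) * \<phi> $ j))"
    by (rule sum.swap)
  also have "\<dots> = (\<Sum>k\<le>d. a k * ((H ^\<^sub>m k) *\<^sub>v \<phi>) $ z)"
    using H \<phi> z by (simp add: scalar_prod_def atLeast0LessThan sum_distrib_left)
  finally show ?thesis .
qed

section \<open>Assembly of the block encoding\<close>

theorem theorem3:
  fixes n d :: nat
    and \<theta> :: real
    and H P\<^sub>R P\<^sub>L POLY\<^sub>R POLY\<^sub>L :: "complex mat"
    and \<alpha> :: "nat \<Rightarrow> nat \<Rightarrow> complex"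
    and a :: "nat \<Rightarrow> complex"
  assumes "n \<ge> 1" and "d \<ge> 1"
    and "H \<in> carrier_mat (2 ^ n) (2 ^ n)" and "H \<noteq> 0\<^sub>m (2 ^ n) (2 ^ n)"
    and "a d \<noteq> 0"
    and "H = pauli_sum n \<alpha>"
    and "unitary_mat (2 ^ (2 * n)) P\<^sub>R"
    and "P\<^sub>R *\<^sub>v ket (2 * n) 0 = PR_state \<theta> n \<alpha>"
    and "unitary_mat (2 ^ (2 * n)) P\<^sub>L"
    and "P\<^sub>L *\<^sub>v ket (2 * n) 0 = PL_state n \<alpha>"
    and "unitary_mat (2 ^ d) POLY\<^sub>R"
    and "POLY\<^sub>R *\<^sub>v ket d 0 = POLYR_state \<theta> d a (coeff_norm n \<alpha>)"
    and "unitary_mat (2 ^ d) POLY\<^sub>L"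
    and "POLY\<^sub>L *\<^sub>v ket d 0 = POLYL_state d a (coeff_norm n \<alpha>)"
  shows "\<exists>c. c \<noteq> 0 \<and>
    (\<forall>\<phi> \<in> carrier_vec (2 ^ n).
       (bra0 d \<otimes>\<^sub>m bra0 (2 * d * n) \<otimes>\<^sub>m 1\<^sub>m (2 ^ n)) *\<^sub>v
         (circuit n d P\<^sub>R P\<^sub>L POLY\<^sub>R POLY\<^sub>L *\<^sub>v (ket d 0 \<otimes>\<^sub>v ket (2 * d * n) 0 \<otimes>\<^sub>v \<phi>))
       = c \<cdot>\<^sub>v (matrix_poly (2 ^ n) d a H *\<^sub>v \<phi>))"
proof -
  interpret circuit_registers n d .
  let ?N = "coeff_norm n \<alpha>"
  \<comment> \<open>The common factor in \<open>POLY_states_sum\<close>: a phase over a positive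
    norm, so it is nonzero, and it is the same for all \<open>\<phi>\<close>.\<close>
  define c where "c = cis (- arg_at0 \<theta> (a 0)) / complex_of_real (poly_norm d a ?N)"
  have N: "?N > 0" using assms(4,6) coeff_norm_pos by simp
  have W: "poly_norm d a ?N > 0" by (rule poly_norm_pos[where a = a and d = d, OF N assms(5)])
  have car: "P\<^sub>R \<in> carrier_mat (2 ^ (2 * n)) (2 ^ (2 * n))" "P\<^sub>L \<in> carrier_mat (2 ^ (2 * n)) (2 ^ (2 * n))"
    "POLY\<^sub>R \<in> carrier_mat (2 ^ d) (2 ^ d)" "POLY\<^sub>L \<in> carrier_mat (2 ^ d) (2 ^ d)"
    using assms by (simp_all add: unitary_mat_def)
  define K where "K = complex_of_real (1 / ?N) \<cdot>\<^sub>m H"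
  have K: "K \<in> carrier_mat (2 ^ n) (2 ^ n)" using assms(3) by (simp add: K_def)
  have K_eq: "K $$ (i, j) = (\<Sum>t<2 ^ (2 * n). cnj ((P\<^sub>L *\<^sub>v ket (2 * n) 0) $ t) * (P\<^sub>R *\<^sub>v ket (2 * n) 0) $ t
      * pauli_block n t $$ (i, j))" if ij: "i < 2 ^ n" "j < 2 ^ n" for i j
  proof -
    have "K $$ (i, j) = complex_of_real (1 / ?N) * pauli_sum n \<alpha> $$ (i, j)"
      using ij assms(3) unfolding K_def assms(6) by (intro index_smult_mat) auto
    also have "\<dots> = (\<Sum>t<2 ^ (2 * n). cnj (PL_state n \<alpha> $ t) * PR_state \<theta> n \<alpha> $ t * pauli_block n t $$ (i, j))"
      unfolding pauli_sum_index[OF ij] sum_distrib_left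
      by (intro sum.cong) (auto simp: PL_PR_state_index[OF N])
    finally show ?thesis by (simp only: assms(8,10))
  qed
  show ?thesis
  proof (intro exI[of _ c] conjI ballI)
    show "c \<noteq> 0" using W by (simp add: c_def)
    fix \<phi> :: "complex vec" assume \<phi>: "\<phi> \<in> carrier_vec (2 ^ n)"
    let ?v = "circuit n d P\<^sub>R P\<^sub>L POLY\<^sub>R POLY\<^sub>L *\<^sub>v (ket d 0 \<otimes>\<^sub>v ket (2 * d * n) 0 \<otimes>\<^sub>v \<phi>)"
    have v: "?v \<in> carrier_vec (2 ^ m)"
      by (intro carrier_vecI) (simp add: circuit_def Let_def carrier_matD[OF gate_on_carrier])
    show "(bra0 d \<otimes>\<^sub>m bra0 (2 * d * n) \<otimes>\<^sub>m 1\<^sub>m (2 ^ n)) *\<^sub>v ?v = c \<cdot>\<^sub>v (matrix_poly (2 ^ n) d a H *\<^sub>v \<phi>)"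
      unfolding project_ancillas[OF v]
    proof (rule eq_vecI)
      have dim: "dim_vec (matrix_poly (2 ^ n) d a H *\<^sub>v \<phi>) = 2 ^ n"
        by (simp add: matrix_poly_def mat_sum_def)
      then show "dim_vec (vec (2 ^ n) (\<lambda>z. ?v $ z)) = dim_vec (c \<cdot>\<^sub>v (matrix_poly (2 ^ n) d a H *\<^sub>v \<phi>))"
        by simp
      fix z assume "z < dim_vec (c \<cdot>\<^sub>v (matrix_poly (2 ^ n) d a H *\<^sub>v \<phi>))"
      then have z: "z < 2 ^ n" by (simp add: dim[simplified])
      have pow: "((K ^\<^sub>m k) *\<^sub>v \<phi>) $ z = complex_of_real (1 / ?N) ^ k * ((H ^\<^sub>m k) *\<^sub>v \<phi>) $ z" for k
        unfolding K_def pow_smult_mat[OF assms(3)] using assms(3) \<phi> z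
        by (simp add: scalar_prod_def sum_distrib_left mult.assoc)
      have "?v $ z = (\<Sum>t<2 ^ d. cnj ((POLY\<^sub>L *\<^sub>v ket d 0) $ t) * (POLY\<^sub>R *\<^sub>v ket d 0) $ t
          * ((K ^\<^sub>m (\<Sum>q<d. qbit d t q)) *\<^sub>v \<phi>) $ z)"
        by (rule circuit_amplitude[OF car K _ \<phi> z]) (rule K_eq)
      \<comment> \<open>Pulling the scalar out of the power of \<open>K\<close> leaves a function of
        the number of ones of \<open>t\<close>, to which the sum over the outer branches
        applies.\<close>
      also have "\<dots> = c * (\<Sum>k\<le>d. a k * ((H ^\<^sub>m k) *\<^sub>v \<phi>) $ z)"
        unfolding assms(12,14) pow
        using POLY_states_sum[OF N W, of \<theta> "\<lambda>k. ((H ^\<^sub>m k) *\<^sub>v \<phi>) $ z"] by (simp only: c_def)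
      finally show "vec (2 ^ n) (\<lambda>z. ?v $ z) $ z = (c \<cdot>\<^sub>v (matrix_poly (2 ^ n) d a H *\<^sub>v \<phi>)) $ z"
        using z dim by (simp only: index_vec index_smult_vec matrix_poly_mult_vec[OF assms(3) \<phi> z])
    qed
  qed
qed

end
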